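(* Suppose there are positive constants $c_0,c_1$ such that $$c_0\tilde\Phi(v_1,v_2,v_3)\le\Phi(R,v_1,v_2,v_3)\le c_1\tilde\Phi(v_1,v_2,v_3)\quad\text{for all }R\in[0,1],\ v_1,v_2,v_3>0,$$ where $\tilde\Phi:(0,\infty)^3\to[0,\infty)$ is symmetric (the stored energy of an isotropic and frame indifferent material), satisfies the growth condition (G) of the context, and satisfies: for any $\eta>1$, the function $$v\mapsto\frac{v^2}{(v^3-1)^2}\,\tilde\Phi\left(\frac{1}{v^2},v,v\right)$$ belongs to $L^1(\eta,\infty)$. Then for $\lambda$ sufficiently large every minimizer $r$ of $I$ over $\mathcal{A}_\lambda$ satisfies $r(0)>0$; that is, there exists $\lambda^*>0$ such that for every $\lambda\ge\lambda^*$ and every $r\in\mathcal{A}_\lambda$ with $I(r)=\inf_{\mathcal{A}_\lambda}I$ one has $r(0)>0$.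
   Context: $\Phi:[0,1]\times(0,\infty)^3\to[0,\infty)$, $(R,v_1,v_2,v_3)\mapsto\Phi(R,v_1,v_2,v_3)$, is a stored energy function, symmetric in its last three arguments. The reference mass density $\rho_0:[0,1]\to\mathbb{R}$ satisfies $k_0\le\rho_0(R)\le k_1$ for $0\le R\le 1$, with positive constants $k_0,k_1$, and $M_R=4\pi\int_0^R\rho_0(u)u^2\,du$. Define $$I(r)=I_{\rm mec}(r)-I_{\rm pot}(r),\quad I_{\rm mec}(r)=\int_0^1\Phi\left(R,r'(R),\tfrac{r(R)}{R},\tfrac{r(R)}{R}\right)R^2\,dR,\quad I_{\rm pot}(r)=\int_0^1\rho_0(R)\frac{M_R}{r(R)}R^2\,dR,$$ and, for $\lambda>0$, $$\mathcal{A}_\lambda=\{r\in W^{1,1}(0,1): r(1)=\lambda,\ r'(R)>0\text{ for a.e. }R\in(0,1),\ r(0)\ge0,\ I_{\rm mec}(r)<\infty\}.$$ The map $R\mapsto\lambda R$ belongs to $\mathcal{A}_\lambda$. Growth condition (G): a function $\Psi$ of $(R,v_1,v_2,v_3)$ (or of $(v_1,v_2,v_3)$ alone) satisfies (G) if $\Psi\ge\phi(v_1)+\phi(v_2)+\phi(v_3)+h(v_1v_2v_3)$ for all arguments, where $\phi,h:(0,\infty)\to(0,\infty)$ are strictly convex, $\phi(v)\ge Cv^\gamma$ for some $C>0$ and $1<\gamma<3$; $h(d)/d\to\infty$ as $d\to\infty$; and $h(d)\ge Kd^{-s}$ for all $d>0$, for some $K>0$ and $s\ge\gamma^*=\frac{\gamma}{\gamma-1}$.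 Standing assumption: $\Phi$ satisfies (G). *)

theory Defs
  imports "HOL-Analysis.Analysis"
begin

section \<open>The Sobolev space $W^{1,1}$ of an interval\<close>

definition test_function :: "real \<Rightarrow> real \<Rightarrow> (real \<Rightarrow> real) \<Rightarrow> bool" where
  "test_function a b \<phi> \<longleftrightarrow>
     \<phi> C1_differentiable_on UNIV \<and>
     (\<exists>K. compact K \<and> K \<subseteq> {a<..<b} \<and> (\<forall>x. x \<notin> K \<longrightarrow> \<phi> x = 0))"

text \<open>Weak derivatives on the interval (a,b) are taken against $C^1_c$ test functions, as in
  Brezis, Functional Analysis, Sobolev Spaces and Partial Differential Equations, Section 8.2.\<close>

definition has_weak_deriv :: "real \<Rightarrow> real \<Rightarrow> (real \<Rightarrow> real) \<Rightarrow> (real \<Rightarrow> real) \<Rightarrow> bool" where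
  "has_weak_deriv a b u g \<longleftrightarrow>
     u absolutely_integrable_on {a<..<b} \<and> g absolutely_integrable_on {a<..<b} \<and>
     (\<forall>\<phi>. test_function a b \<phi> \<longrightarrow>
        (LINT x:{a<..<b}|lebesgue. u x * deriv \<phi> x) = - (LINT x:{a<..<b}|lebesgue. g x * \<phi> x))"

definition W11 :: "real \<Rightarrow> real \<Rightarrow> (real \<Rightarrow> real) set" where
  "W11 a b = {u. \<exists>g. has_weak_deriv a b u g}"

text \<open>For u in \<open>W11 a b\<close> the weak derivative is unique up to a null set; \<open>weak_deriv\<close>
  picks one version of it, and everything below is insensitive to the choice.\<close>

definition weak_deriv :: "real \<Rightarrow> real \<Rightarrow> (real \<Rightarrow> real) \<Rightarrow> real \<Rightarrow> real" where
  "weak_deriv a b u = (SOME g. has_weak_deriv a b u g)"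


section \<open>Stored energy functions\<close>

definition strictly_convex_on :: "real set \<Rightarrow> (real \<Rightarrow> real) \<Rightarrow> bool" where
  "strictly_convex_on S f \<longleftrightarrow> convex S \<and>
     (\<forall>x\<in>S. \<forall>y\<in>S. \<forall>t. x \<noteq> y \<longrightarrow> 0 < t \<longrightarrow> t < 1 \<longrightarrow>
        f ((1 - t) * x + t * y) < (1 - t) * f x + t * f y)"

text \<open>Invariance under the two adjacent transpositions, which generate all permutations of the
  three arguments.\<close>

definition symmetric3 :: "(real \<Rightarrow> real \<Rightarrow> real \<Rightarrow> real) \<Rightarrow> bool" where
  "symmetric3 F \<longleftrightarrow> (\<forall>v\<^sub>1>0. \<forall>v\<^sub>2>0. \<forall>v\<^sub>3>0.
     F v\<^sub>1 v\<^sub>2 v\<^sub>3 = F v\<^sub>2 v\<^sub>1 v\<^sub>3 \<and> F v\<^sub>1 v\<^sub>2 v\<^sub>3 = F v\<^sub>1 v\<^sub>3 v\<^sub>2)"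

text \<open>The growth condition (G). A function of $(v_1,v_2,v_3)$ alone is treated as a function of
  $(R,v_1,v_2,v_3)$ that does not depend on R.\<close>

definition growth_condition :: "(real \<Rightarrow> real \<Rightarrow> real \<Rightarrow> real \<Rightarrow> real) \<Rightarrow> bool" where
  "growth_condition \<Psi> \<longleftrightarrow>
     (\<exists>\<phi> h :: real \<Rightarrow> real. \<exists>C \<gamma> K s :: real.
        (\<forall>v>0. \<phi> v > 0) \<and> (\<forall>d>0. h d > 0) \<and>
        strictly_convex_on {0<..} \<phi> \<and> strictly_convex_on {0<..} h \<and>
        C > 0 \<and> 1 < \<gamma> \<and> \<gamma> < 3 \<and> (\<forall>v>0. \<phi> v \<ge> C * v powr \<gamma>) \<and>
        filterlim (\<lambda>d. h d / d) at_top at_top \<and>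
        K > 0 \<and> s \<ge> \<gamma> / (\<gamma> - 1) \<and> (\<forall>d>0. h d \<ge> K * d powr (- s)) \<and>
        (\<forall>R\<in>{0..1}. \<forall>v\<^sub>1>0. \<forall>v\<^sub>2>0. \<forall>v\<^sub>3>0.
           \<Psi> R v\<^sub>1 v\<^sub>2 v\<^sub>3 \<ge> \<phi> v\<^sub>1 + \<phi> v\<^sub>2 + \<phi> v\<^sub>3 + h (v\<^sub>1 * v\<^sub>2 * v\<^sub>3)))"


section \<open>The energy functional and its domain\<close>

text \<open>Both integrands are nonnegative a.e. on the admissible class, so the two energies are
  integrals with values in $[0,\infty]$. For integrands that are not measurable, \<open>nn_integral\<close>
  is the lower integral. \<open>ennreal\<close> sends negative numbers to 0, so these definitions mean
  what they should only for r that are positive on (0,1) with positive derivative a.e.\<close>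

definition mass_inside :: "(real \<Rightarrow> real) \<Rightarrow> real \<Rightarrow> real" where
  "mass_inside \<rho>\<^sub>0 R = 4 * pi * (LINT u:{0..R}|lebesgue. \<rho>\<^sub>0 u * u\<^sup>2)"

definition I_mec :: "(real \<Rightarrow> real \<Rightarrow> real \<Rightarrow> real \<Rightarrow> real) \<Rightarrow> (real \<Rightarrow> real) \<Rightarrow> ennreal" where
  "I_mec \<Phi> r =
     (\<integral>\<^sup>+R\<in>{0<..<1}. ennreal (\<Phi> R (weak_deriv 0 1 r R) (r R / R) (r R / R) * R\<^sup>2) \<partial>lebesgue)"

definition I_pot :: "(real \<Rightarrow> real) \<Rightarrow> (real \<Rightarrow> real) \<Rightarrow> ennreal" where
  "I_pot \<rho>\<^sub>0 r =
     (\<integral>\<^sup>+R\<in>{0<..<1}. ennreal (\<rho>\<^sub>0 R * (mass_inside \<rho>\<^sub>0 R / r R) * R\<^sup>2) \<partial>lebesgue)"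

definition energy ::
  "(real \<Rightarrow> real \<Rightarrow> real \<Rightarrow> real \<Rightarrow> real) \<Rightarrow> (real \<Rightarrow> real) \<Rightarrow> (real \<Rightarrow> real) \<Rightarrow> ereal" where
  "energy \<Phi> \<rho>\<^sub>0 r = enn2ereal (I_mec \<Phi> r) - enn2ereal (I_pot \<rho>\<^sub>0 r)"

text \<open>Elements of $W^{1,1}(0,1)$ are identified with their representative that is continuous on
  [0,1]; this gives the boundary values r(0) and r(1) their meaning. Values of r outside [0,1] are
  irrelevant.\<close>

definition admissible ::
  "(real \<Rightarrow> real \<Rightarrow> real \<Rightarrow> real \<Rightarrow> real) \<Rightarrow> real \<Rightarrow> (real \<Rightarrow> real) set" where
  "admissible \<Phi> lam =
     {r. r \<in> W11 0 1 \<and> continuous_on {0..1} r \<and> r 1 = lam \<and>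
         (AE R in lebesgue_on {0<..<1}. weak_deriv 0 1 r R > 0) \<and>
         r 0 \<ge> 0 \<and> I_mec \<Phi> r < \<infinity>}"

end

theory Submission
  imports Defs
begin

text \<open>Among maps with r(0) = 0 the superlinear growth of h in the volume ratio
  \<open>d = r' (r / R)\<^sup>2\<close> forces the mechanical energy E to grow faster than any multiple of
  \<open>\<lambda>\<^sup>3\<close>, because the integral of \<open>d R\<^sup>2\<close> is of order \<open>\<lambda>\<^sup>3\<close>. The lower bound
  \<open>h d \<ge> K (1 / d - 1)\<close> keeps r(R) away from 0 well enough that the potential energy is at
  most E/2 plus a constant. The incompressible map \<open>R \<mapsto> (R\<^sup>3 + \<lambda>\<^sup>3 - 1)\<^bsup>1/3\<^esup>\<close> opens a
  cavity, and substituting v = r(R)/R shows that its mechanical energy is \<open>O(\<lambda>\<^sup>3)\<close>; so for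
  large \<open>\<lambda>\<close> it beats every admissible map without a cavity.\<close>

section \<open>Weak derivatives on an interval\<close>

text \<open>\<open>\<Phi>\<close> is not assumed measurable, so \<open>I_mec\<close> is only a lower
  integral, and of r only the integrability of its weak derivative r' is at hand. Lower bounds
  therefore come from minorants affine in r'. In them \<open>d * R\<^sup>2\<close> equals r' r^2,
  and the factor r^2 is replaced by a constant: at least lambda^2 / 4 beyond the point where r =
  lambda / 2, at most r(x)^2 on (0,x). What is left to integrate is r' itself, so the fundamental
  theorem for weak derivatives suffices and a chain rule for r^3 is avoided.
  \<open>weak_deriv\<close> is an arbitrary choice among versions; its a.e. uniqueness is what
  allows the energy of the explicit comparison map to be computed. The potential energy is absorbed
  through \<open>t \<le> t ^ 3 / m\<^sup>2 + m\<close>, whose free parameter m is tuned to the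
  coefficient 1/2.\<close>

definition tent :: "real \<Rightarrow> real" where
  "tent t = 4 * (max 0 t - 2 * max 0 (t - 1/2) + max 0 (t - 1))"

text \<open>The antiderivative of \<open>tent\<close>, the hat function on [0,1] with height 2 and
  integral 1. Test functions need only be C^1, so a piecewise quadratic step is smooth enough.
  Positive parts give one formula for all pieces, from which the derivative is read off
  termwise.\<close>

definition smoothstep :: "real \<Rightarrow> real" where
  "smoothstep t = 2 * ((max 0 t)\<^sup>2 - 2 * (max 0 (t - 1/2))\<^sup>2 + (max 0 (t - 1))\<^sup>2)"

section \<open>A C^1 step and the approximate identity formed by its derivative\<close>

lemma has_real_derivative_square_pos_part:
  "((\<lambda>t. (max 0 t)\<^sup>2) has_real_derivative 2 * max 0 t) (at (t::real))"
proof (cases t "0::real" rule: linorder_cases)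
  case less
  have "((\<lambda>t::real. 0) has_real_derivative 2 * max 0 t) (at t)" using less by simp
  then show ?thesis
    by (rule has_field_derivative_transform_within_open[of _ _ _ "{..<0}"]) (use less in auto)
next
  case greater
  have "((\<lambda>t::real. t\<^sup>2) has_real_derivative 2 * max 0 t) (at t)"
    using greater by (auto intro!: derivative_eq_intros)
  then show ?thesis
    by (rule has_field_derivative_transform_within_open[of _ _ _ "{0<..}"]) (use greater in auto)
next
  case equal
  have "((\<lambda>h::real. (max 0 h)\<^sup>2 / h) \<longlongrightarrow> 0) (at 0)"
  proof (rule tendsto_0_le[where K = 1 and f = "\<lambda>h. h"])
    show "\<forall>\<^sub>F h in at (0::real). norm ((max 0 h)\<^sup>2 / h) \<le> norm h * (1::real)"
      by (rule always_eventually) (auto simp: max_def power2_eq_square)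
  qed auto
  then show ?thesis using equal by (simp add: DERIV_def)
qed

lemma has_real_derivative_smoothstep: "(smoothstep has_real_derivative tent t) (at t)"
proof -
  have "((\<lambda>t. (max 0 (t - c))\<^sup>2) has_real_derivative 2 * max 0 (t - c)) (at t)" for c :: real
    by (rule DERIV_cong[OF DERIV_chain2[where g = "\<lambda>t. t - c", OF has_real_derivative_square_pos_part]])
       (auto intro!: derivative_eq_intros)
  note d = has_real_derivative_square_pos_part[of t] this[of "1/2"] this[of 1]
  show ?thesis
    unfolding smoothstep_def[abs_def] tent_def
    by (rule derivative_eq_intros d refl | simp add: algebra_simps)+
qed

lemma continuous_on_tent: "continuous_on S tent"
  unfolding tent_def[abs_def] by (intro continuous_intros)

lemma tent_nonneg: "0 \<le> tent t" and tent_eq_0: "t \<notin> {0<..<1} \<Longrightarrow> tent t = 0"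
  by (auto simp: tent_def max_def)

lemma smoothstep_eq_0: "t \<le> 0 \<Longrightarrow> smoothstep t = 0"
  by (auto simp: smoothstep_def max_def)

lemma smoothstep_eq_1: "1 \<le> t \<Longrightarrow> smoothstep t = 1"
  by (auto simp: smoothstep_def max_def power2_eq_square algebra_simps)

lemma smoothstep_range: "0 \<le> smoothstep t" "smoothstep t \<le> 1"
proof -
  have m: "smoothstep s \<le> smoothstep t" if "s \<le> t" for s t
    using that by (rule DERIV_nonneg_imp_nondecreasing)
      (use has_real_derivative_smoothstep tent_nonneg in blast)
  show "0 \<le> smoothstep t" using m[of "min t 0" t] by (simp add: smoothstep_eq_0)
  show "smoothstep t \<le> 1" using m[of t "max t 1"] by (simp add: smoothstep_eq_1)
qed

lemma has_real_derivative_scaled_smoothstep: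
  "((\<lambda>t. smoothstep (c * (t - x))) has_real_derivative c * tent (c * (t - x))) (at t)"
  by (rule DERIV_cong[OF DERIV_chain2[where g = "\<lambda>t. c * (t - x)" and Db = c, OF has_real_derivative_smoothstep]])
     (auto intro!: derivative_eq_intros)

text \<open>The ramp rises on [x, x + 1/n], to the right of x. At t = x its value is 0 for every n,
  hence the open half-line.\<close>

lemma tendsto_smoothstep:
  "(\<lambda>n. smoothstep (real n * (t - x))) \<longlonglongrightarrow> indicator {x<..} t"
proof (cases "x < t")
  case True
  then obtain N :: nat where N: "inverse (t - x) < real N" using reals_Archimedean2 by blast
  have "1 \<le> real n * (t - x)" if "n \<ge> N" for n
  proof -
    have "inverse (t - x) * (t - x) \<le> real n * (t - x)"
      using N that True by (intro mult_right_mono) auto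
    with True show ?thesis by simp
  qed
  then have "\<forall>\<^sub>F n in sequentially. smoothstep (real n * (t - x)) = indicator {x<..} t"
    using True by (auto simp: eventually_sequentially smoothstep_eq_1 intro!: exI[of _ N])
  then show ?thesis by (rule tendsto_eventually)
next
  case False
  then show ?thesis by (simp add: smoothstep_eq_0 mult_nonneg_nonpos)
qed

text \<open>The kernel is non-negative, has mass 1 and lives on [x, x + 1/n], so the integral is an
  average of u over a shrinking interval and continuity at x gives the limit.\<close>

lemma tendsto_integral_tent:
  fixes u :: "real \<Rightarrow> real"
  assumes u: "continuous_on {a..b} u" and x: "a < x" "x < b"
  shows "(\<lambda>n. integral {a<..<b} (\<lambda>t. u t * (real n * tent (real n * (t - x))))) \<longlonglongrightarrow> u x"
proof (rule LIMSEQ_I)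
  fix e :: real assume "0 < e"
  then have e: "0 < e/2" by simp
  from u x have "isCont u x" by (simp add: continuous_on_interior)
  then obtain d where d: "d > 0" "\<And>t. \<bar>t - x\<bar> < d \<Longrightarrow> \<bar>u t - u x\<bar> < e/2"
    using e unfolding continuous_at_real_range real_norm_def by metis
  \<comment> \<open>The minimum serves two ends: the kernel stays where u is within e/2 of u x, and
    its support stays below b, so that none of its mass is lost.\<close>
  obtain N :: nat where N: "inverse (min d (b - x)) < real N" using reals_Archimedean2 by blast
  have "norm (integral {a<..<b} (\<lambda>t. u t * (real n * tent (real n * (t - x)))) - u x) < e" if n: "n \<ge> N" for n
  proof -
    have mp: "0 < min d (b - x)" using d x by auto
    have "inverse (min d (b - x)) < real n" using N n by linarith
    with mp have n0: "real n > 0" by (metis less_trans positive_imp_inverse_positive)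
    with \<open>inverse (min d (b - x)) < real n\<close> mp have "1 / real n < min d (b - x)"
      by (metis inverse_eq_divide inverse_inverse_eq inverse_less_iff_less positive_imp_inverse_positive)
    then have nd: "1 / real n < d" "x + 1 / real n < b" by auto
    define w where "w t = real n * tent (real n * (t - x))" for t
    have w0: "w t \<ge> 0" for t by (simp add: w_def tent_nonneg)
    have wz: "w t = 0" if "t \<notin> {x..x + 1/real n}" for t
    proof -
      have "real n * (t - x) \<notin> {0<..<1}"
        using that n0 by (auto simp: zero_less_mult_iff field_simps)
      then show ?thesis by (simp add: w_def tent_eq_0)
    qed
    have w1: "(w has_integral 1) {x..x + 1/real n}"
      using fundamental_theorem_of_calculus[of x "x + 1/real n" "\<lambda>t. smoothstep (real n * (t - x))" w] n0
      by (simp add: w_def has_real_derivative_iff_has_vector_derivative[symmetric]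
          has_field_derivative_at_within has_real_derivative_scaled_smoothstep smoothstep_eq_0 smoothstep_eq_1)
    have sub: "{x..x + 1/real n} \<subseteq> {a..b}" using x nd by auto
    have cw: "continuous_on S w" for S
      unfolding w_def by (intro continuous_intros continuous_on_compose2[OF continuous_on_tent[of UNIV]]) auto
    have int: "((\<lambda>t. u t * w t) has_integral integral {x..x + 1/real n} (\<lambda>t. u t * w t)) {x..x + 1/real n}"
      by (intro integrable_integral integrable_continuous_real continuous_intros cw continuous_on_subset[OF u sub])
    have bd: "u x - e/2 \<le> u t" "u t \<le> u x + e/2" if "t \<in> {x..x + 1/real n}" for t
    proof -
      have "\<bar>u t - u x\<bar> < e/2" using nd that by (intro d(2)) auto
      then show "u x - e/2 \<le> u t" "u t \<le> u x + e/2" by linarith+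
    qed
    have "integral {a<..<b} (\<lambda>t. u t * w t) = integral {x..x + 1/real n} (\<lambda>t. u t * w t)"
      by (rule integral_spike_set)
         (use wz x nd in \<open>auto intro: negligible_subset[OF negligible_empty]\<close>)
    moreover have "integral {x..x + 1/real n} (\<lambda>t. u t * w t) \<le> (u x + e/2) * 1"
      by (rule has_integral_le[OF int has_integral_mult_right[OF w1]])
         (intro mult_right_mono bd w0)
    moreover have "(u x - e/2) * 1 \<le> integral {x..x + 1/real n} (\<lambda>t. u t * w t)"
      by (rule has_integral_le[OF has_integral_mult_right[OF w1] int])
         (intro mult_right_mono bd w0)
    ultimately show ?thesis unfolding w_def using \<open>0 < e\<close> by (auto simp: abs_less_iff)
  qed
  then show "\<exists>N. \<forall>n\<ge>N. norm (integral {a<..<b} (\<lambda>t. u t * (real n * tent (real n * (t - x)))) - u x) < e"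
    by blast
qed

text \<open>The test functions f n tend to the indicator of (x,y], while their derivatives tend to the
  difference of the point masses at x and y.\<close>

lemma has_weak_deriv_imp_has_integral_interior:
  assumes w: "has_weak_deriv a b u g" and u: "continuous_on {a..b} u"
    and xy: "a < x" "x \<le> y" "y < b"
  shows "(g has_integral (u y - u x)) {x..y}"
proof -
  define f where "f n t = smoothstep (real n * (t - x)) - smoothstep (real n * (t - y))" for n t
  define f' where "f' n t = real n * tent (real n * (t - x)) - real n * tent (real n * (t - y))" for n t
  have f': "(f n has_real_derivative f' n t) (at t)" for n t
    unfolding f_def f'_def by (intro DERIV_diff has_real_derivative_scaled_smoothstep)
  have cf': "continuous_on S (f' n)" for S n
    unfolding f'_def by (intro continuous_intros continuous_on_compose2[OF continuous_on_tent[of UNIV]]) auto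
  have cf: "continuous_on S (f n)" for S n
    using f' by (meson DERIV_isCont continuous_at_imp_continuous_on)
  obtain N :: nat where N: "inverse (b - y) < real N" using reals_Archimedean2 by blast
  have test: "test_function a b (f n)" if n: "n \<ge> N" for n
    unfolding test_function_def
  proof (intro conjI exI allI impI)
    have "inverse (b - y) < real n" using N n by linarith
    moreover have "0 < inverse (b - y)" using xy by simp
    ultimately have n0: "real n > 0" by linarith
    have "1 / real n < b - y"
      using \<open>inverse (b - y) < real n\<close> n0 xy
      by (metis diff_gt_0_iff_gt inverse_eq_divide inverse_inverse_eq inverse_less_iff_less positive_imp_inverse_positive)
    \<comment> \<open>The compact support must lie in the open interval, which is why x and y are
      interior points here; the end points are recovered later by continuity.\<close>
    then show "{x..y + 1/real n} \<subseteq> {a<..<b}" using xy by auto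
    show "f n C1_differentiable_on UNIV"
      unfolding C1_differentiable_on_def
      using f' cf' by (auto simp: has_real_derivative_iff_has_vector_derivative intro!: exI[of _ "f' n"])
    fix t assume t: "t \<notin> {x..y + 1/real n}"
    show "f n t = 0"
    proof (cases "t < x")
      case True
      then show ?thesis using n0 xy by (simp add: f_def smoothstep_eq_0 mult_nonneg_nonpos)
    next
      case False
      with t have "1 / real n < t - y" by auto
      then have "1 < real n * (t - y)" using n0 by (simp add: field_simps)
      moreover have "real n * (t - y) \<le> real n * (t - x)" using xy by (intro mult_left_mono) auto
      ultimately show ?thesis by (simp add: f_def smoothstep_eq_1)
    qed
  qed auto
  have g: "set_integrable lebesgue {a<..<b} g" using w by (simp add: has_weak_deriv_def)
  have 1: "(\<lambda>n. LINT t:{a<..<b}|lebesgue. u t * deriv (f n) t) \<longlonglongrightarrow> u x - u y"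
  proof -
    have ai: "(\<lambda>t. u t * (real n * tent (real n * (t - z)))) absolutely_integrable_on {a<..<b}" for n z
    proof (rule set_integrable_subset)
      show "(\<lambda>t. u t * (real n * tent (real n * (t - z)))) absolutely_integrable_on {a..b}"
        by (intro absolutely_integrable_continuous_real continuous_intros u
            continuous_on_compose2[OF continuous_on_tent[of UNIV]]) auto
    qed auto
    have "(LINT t:{a<..<b}|lebesgue. u t * deriv (f n) t) =
      integral {a<..<b} (\<lambda>t. u t * (real n * tent (real n * (t - x))))
      - integral {a<..<b} (\<lambda>t. u t * (real n * tent (real n * (t - y))))" for n
      unfolding DERIV_imp_deriv[OF f'] f'_def right_diff_distrib[of "u t" for t]
      using set_integral_diff(2)[OF ai[of n x] ai[of n y]]
      by (simp only: set_lebesgue_integral_eq_integral(2)[OF ai])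
    then show ?thesis
      using tendsto_diff[OF tendsto_integral_tent[OF u] tendsto_integral_tent[OF u]] xy by simp
  qed
  \<comment> \<open>On this side g is merely integrable, so the limit is taken by dominated
    convergence, with majorant |g| because |f n| is at most 1.\<close>
  have 2: "(\<lambda>n. LINT t:{a<..<b}|lebesgue. g t * f n t) \<longlonglongrightarrow>
      (LINT t:{a<..<b}|lebesgue. g t * indicator {x<..y} t)"
    unfolding set_lebesgue_integral_def
  proof (rule integral_dominated_convergence[where w = "\<lambda>t. \<bar>indicator {a<..<b} t * g t\<bar>"])
    have ig: "integrable lebesgue (\<lambda>t. indicator {a<..<b} t * g t)"
      using g by (simp add: set_integrable_def)
    then show "integrable lebesgue (\<lambda>t. \<bar>indicator {a<..<b} t * g t\<bar>)" by simp
    note m = borel_measurable_integrable[OF ig]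
    have "(\<lambda>t. (indicator {a<..<b} t * g t) * indicator {x<..y} t) \<in> borel_measurable lebesgue"
      by (intro borel_measurable_times m borel_measurable_indicator) auto
    then show "(\<lambda>t. indicator {a<..<b} t *\<^sub>R (g t * indicator {x<..y} t)) \<in> borel_measurable lebesgue"
      by (simp add: mult.assoc)
    show "(\<lambda>t. indicator {a<..<b} t *\<^sub>R (g t * f n t)) \<in> borel_measurable lebesgue" for n
    proof -
      have "f n \<in> borel_measurable lebesgue"
        by (intro measurable_completion) (simp add: borel_measurable_continuous_onI cf)
      then have "(\<lambda>t. (indicator {a<..<b} t * g t) * f n t) \<in> borel_measurable lebesgue"
        by (intro borel_measurable_times m)
      then show ?thesis by (simp add: mult.assoc)
    qed
    have "(\<lambda>n. f n t) \<longlonglongrightarrow> indicator {x<..y} t" for t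
    proof -
      have "(\<lambda>n. f n t) \<longlonglongrightarrow> indicator {x<..} t - indicator {y<..} t"
        unfolding f_def by (intro tendsto_diff tendsto_smoothstep)
      also have "indicator {x<..} t - indicator {y<..} t = (indicator {x<..y} t :: real)"
        using xy by (auto simp: indicator_def)
      finally show ?thesis .
    qed
    then show "AE t in lebesgue. (\<lambda>n. indicator {a<..<b} t *\<^sub>R (g t * f n t)) \<longlonglongrightarrow>
        indicator {a<..<b} t *\<^sub>R (g t * indicator {x<..y} t)"
      by (intro AE_I2 tendsto_intros)
    have "\<bar>f n t\<bar> \<le> 1" for n t
      using smoothstep_range[of "real n * (t - x)"] smoothstep_range[of "real n * (t - y)"]
      by (auto simp: f_def)
    then show "AE t in lebesgue. norm (indicator {a<..<b} t *\<^sub>R (g t * f n t)) \<le> \<bar>indicator {a<..<b} t * g t\<bar>" for n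
      by (intro AE_I2) (auto simp: abs_mult mult_left_le indicator_def)
  qed
  have "(\<lambda>n. - (LINT t:{a<..<b}|lebesgue. g t * f n t)) \<longlonglongrightarrow> u x - u y"
  proof (rule Lim_transform_eventually[OF 1])
    show "\<forall>\<^sub>F n in sequentially. (LINT t:{a<..<b}|lebesgue. u t * deriv (f n) t) =
        - (LINT t:{a<..<b}|lebesgue. g t * f n t)"
      using w test by (auto simp: has_weak_deriv_def eventually_sequentially intro!: exI[of _ N])
  qed
  from LIMSEQ_unique[OF this tendsto_minus[OF 2]]
  have "(LINT t:{a<..<b}|lebesgue. g t * indicator {x<..y} t) = u y - u x" by simp
  also have "(LINT t:{a<..<b}|lebesgue. g t * indicator {x<..y} t) = (LINT t:{x<..y}|lebesgue. g t)"
    unfolding set_lebesgue_integral_def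
    by (rule Bochner_Integration.integral_cong) (use xy in \<open>auto simp: indicator_def\<close>)
  finally have "(LINT t:{x<..y}|lebesgue. g t) = u y - u x" .
  with has_integral_set_lebesgue[OF set_integrable_subset[OF g, of "{x<..y}"]]
  have "(g has_integral (u y - u x)) {x<..y}" using xy by (auto simp: subset_eq)
  then show ?thesis
  proof (rule has_integral_spike_set_eq[THEN iffD1, rotated 2])
    show "negligible {t \<in> {x<..y} - {x..y}. g t \<noteq> 0}" "negligible {t \<in> {x..y} - {x<..y}. g t \<noteq> 0}"
      by (rule negligible_subset[of "{x}"]; force)+
  qed
qed

text \<open>The difference G of u and the indefinite integral of g is constant on the open interval
  by the interior case. It is continuous on the closed one, so it keeps the same value at the end
  points.\<close>

lemma has_weak_deriv_imp_has_integral: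
  assumes w: "has_weak_deriv a b u g" and u: "continuous_on {a..b} u"
    and xy: "a \<le> x" "x \<le> y" "y \<le> b"
  shows "(g has_integral (u y - u x)) {x..y}"
proof (cases "a < b")
  case True
  have g: "g absolutely_integrable_on {a<..<b}" using w by (simp add: has_weak_deriv_def)
  have gi: "g integrable_on {a..b}"
    using set_lebesgue_integral_eq_integral(1)[OF g] by (simp add: integrable_on_Icc_iff_Ioo)
  define G where "G t = u t - integral {a..t} g" for t
  have cG: "continuous_on {a..b} G"
    unfolding G_def by (intro continuous_intros u indefinite_integral_continuous_1 gi)
  define m where "m = (a + b) / 2"
  have ab: "a < m" "m < b" using True by (auto simp: m_def)
  have eqG: "G s = G t" if "a < s" "s \<le> t" "t < b" for s t
  proof -
    have "integral {s..t} g = u t - u s"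
      using has_weak_deriv_imp_has_integral_interior[OF w u that] by (rule integral_unique)
    moreover have "integral {a..s} g + integral {s..t} g = integral {a..t} g"
      using that by (intro Henstock_Kurzweil_Integration.integral_combine integrable_on_subinterval[OF gi]) auto
    ultimately show ?thesis by (simp add: G_def)
  qed
  have "G t = G m" if "t \<in> {a<..<b}" for t
  proof (cases "t \<le> m")
    case True
    show ?thesis by (rule eqG) (use True that ab in auto)
  next
    case False
    have "G m = G t" by (rule eqG) (use False that ab in auto)
    then show ?thesis ..
  qed
  then have "G t = G m" if "t \<in> {a..b}" for t
    using continuous_constant_on_closure[of "{a<..<b}" G "G m" t] cG that True by simp
  from this[of x] this[of y] have "G x = G y" using xy by simp
  moreover have "integral {a..x} g + integral {x..y} g = integral {a..y} g"
    using xy by (intro Henstock_Kurzweil_Integration.integral_combine integrable_on_subinterval[OF gi]) auto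
  moreover have "g integrable_on {x..y}" by (rule integrable_on_subinterval[OF gi]) (use xy in auto)
  ultimately show ?thesis by (simp add: G_def has_integral_iff)
next
  case False
  with xy have "x = y" by auto
  then show ?thesis by (simp add: has_integral_refl)
qed

section \<open>Uniqueness of weak derivatives and the classical case\<close>

text \<open>The positive and negative parts of f are densities of two measures that are finite and
  equal on every half-line {x<..}. Hence the measures coincide and the densities agree a.e.; since
  at most one of the two parts is nonzero at a point, both vanish.\<close>

lemma AE_lborel_zero_if_tail_integrals_zero:
  fixes f :: "real \<Rightarrow> real"
  assumes f: "integrable lborel f" and z: "\<And>x. (LINT t:{x<..}|lborel. f t) = 0"
  shows "AE t in lborel. f t = 0"
proof -
  have [measurable]: "f \<in> borel_measurable borel" using f by auto
  have "density lborel (\<lambda>t. ennreal (f t)) = density lborel (\<lambda>t. ennreal (- f t))"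
  proof (rule measure_eqI_lessThan)
    fix x :: real
    have i: "integrable lborel (\<lambda>t. indicator {x<..} t * f t)"
      using integrable_mult_indicator[OF _ f, of "{x<..}"] by simp
    have e: "ennreal (c * f t) * indicator {x<..} t = ennreal (c * (indicator {x<..} t * f t))" for t c
      by (simp add: indicator_def)
    have fin: "(\<integral>\<^sup>+t. ennreal (indicator {x<..} t * f t) \<partial>lborel) < \<infinity>"
              "(\<integral>\<^sup>+t. ennreal (- (indicator {x<..} t * f t)) \<partial>lborel) < \<infinity>"
      using real_integrable_def[of lborel "\<lambda>t. indicator {x<..} t * f t"] i by (auto simp: top.not_eq_extremum)
    have "enn2real (\<integral>\<^sup>+t. ennreal (indicator {x<..} t * f t) \<partial>lborel) =
          enn2real (\<integral>\<^sup>+t. ennreal (- (indicator {x<..} t * f t)) \<partial>lborel)"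
      using z[of x] real_lebesgue_integral_def[OF i] by (simp add: set_lebesgue_integral_def)
    then have "(\<integral>\<^sup>+t. ennreal (indicator {x<..} t * f t) \<partial>lborel) =
          (\<integral>\<^sup>+t. ennreal (- (indicator {x<..} t * f t)) \<partial>lborel)"
      using fin by (metis ennreal_enn2real infinity_ennreal_def)
    then show "emeasure (density lborel (\<lambda>t. ennreal (f t))) {x<..} =
        emeasure (density lborel (\<lambda>t. ennreal (- f t))) {x<..}"
      using fin e[of 1] e[of "-1"] by (simp add: emeasure_density)
    show "emeasure (density lborel (\<lambda>t. ennreal (f t))) {x<..} < \<infinity>"
      using fin e[of 1] by (simp add: emeasure_density)
  qed auto
  then have "AE t in lborel. ennreal (f t) = ennreal (- f t)"
    by (intro sigma_finite_measure.density_unique sigma_finite_lborel) auto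
  then show ?thesis
    by eventually_elim (metis ennreal_eq_0_iff ennreal_neg linorder_le_cases neg_le_0_iff_le order_antisym)
qed

lemma AE_zero_if_interval_integrals_zero:
  fixes f :: "real \<Rightarrow> real"
  assumes f: "f absolutely_integrable_on {a<..<b}"
    and z: "\<And>x. a \<le> x \<Longrightarrow> x \<le> b \<Longrightarrow> (f has_integral 0) {x..b}"
  shows "AE t in lebesgue. t \<in> {a<..<b} \<longrightarrow> f t = 0"
proof (cases "a < b")
  case True
  define F where "F t = indicator {a<..<b} t * f t" for t
  have F: "integrable lebesgue F" using f by (simp add: set_integrable_def F_def[abs_def])
  \<comment> \<open>Comparing measures on half-lines determines them on Borel sets, whereas F is
    only Lebesgue measurable; a Borel version G takes its place.\<close>
  from completion_ex_borel_measurable_real[OF borel_measurable_integrable[OF F]]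
  obtain G where G: "G \<in> borel_measurable lborel" "AE t in lborel. F t = G t" by auto
  have FG: "AE t in lebesgue. F t = G t" using G(2) by (rule AE_completion)
  have Gl: "G \<in> borel_measurable lebesgue" using G(1) by (rule measurable_completion)
  have GI: "integrable lebesgue G"
    using integrable_cong_AE_imp[OF F Gl] FG by (auto elim: eventually_mono)
  have tail: "(LINT t:{x<..}|lborel. G t) = 0" for x
  proof -
    have "(LINT t:{x<..}|lborel. G t) = (LINT t:{x<..}|lebesgue. G t)"
      unfolding set_lebesgue_integral_def
      by (rule integral_completion[symmetric]) (use G(1) in auto)
    also have "\<dots> = (LINT t:{x<..}|lebesgue. F t)"
      unfolding set_lebesgue_integral_def
      by (rule integral_cong_AE)
         (use FG borel_measurable_integrable[OF F] Gl in \<open>auto intro!: borel_measurable_times borel_measurable_indicator\<close>)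
    also have "\<dots> = (LINT t:{max a x<..<b}|lebesgue. f t)"
      unfolding set_lebesgue_integral_def F_def
      by (rule Bochner_Integration.integral_cong) (auto simp: indicator_def)
    also have "\<dots> = 0"
    proof (cases "max a x \<le> b")
      case T: True
      have "(LINT t:{max a x<..<b}|lebesgue. f t) = integral {max a x<..<b} f"
        by (rule set_lebesgue_integral_eq_integral(2)[OF set_integrable_subset[OF f]]) auto
      also have "\<dots> = 0"
        using z[of "max a x"] T by (auto simp: integral_open_interval_real[symmetric] dest: integral_unique)
      finally show ?thesis .
    next
      case False
      then have "{max a x<..<b} = {}" by auto
      then show ?thesis by (simp add: set_lebesgue_integral_def)
    qed
    finally show ?thesis .
  qed
  have "AE t in lborel. G t = 0"
    by (rule AE_lborel_zero_if_tail_integrals_zero)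
       (use tail GI G(1) in \<open>auto simp: integrable_completion\<close>)
  then have "AE t in lebesgue. G t = 0" by (rule AE_completion)
  with FG show ?thesis by eventually_elim (auto simp: F_def)
qed auto

text \<open>By the fundamental theorem both versions have the same integral over every
  [x,b].\<close>

lemma has_weak_deriv_unique:
  assumes "has_weak_deriv a b u g" "has_weak_deriv a b u g'" "continuous_on {a..b} u"
  shows "AE t in lebesgue. t \<in> {a<..<b} \<longrightarrow> g t = g' t"
proof -
  have "AE t in lebesgue. t \<in> {a<..<b} \<longrightarrow> g t - g' t = 0"
  proof (rule AE_zero_if_interval_integrals_zero)
    show "(\<lambda>t. g t - g' t) absolutely_integrable_on {a<..<b}"
      using assms by (auto simp: has_weak_deriv_def intro!: set_integral_diff)
    show "((\<lambda>t. g t - g' t) has_integral 0) {x..b}" if "a \<le> x" "x \<le> b" for x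
      using has_integral_diff[OF has_weak_deriv_imp_has_integral[OF assms(1,3) that order_refl]
        has_weak_deriv_imp_has_integral[OF assms(2,3) that order_refl]] by simp
  qed
  then show ?thesis by eventually_elim auto
qed

text \<open>Integration by parts: the integral of the derivative of u times a test function is a
  boundary term, and the test function vanishes at both ends.\<close>

lemma C1_imp_has_weak_deriv:
  assumes u: "\<And>t. t \<in> {a..b} \<Longrightarrow> (u has_real_derivative u' t) (at t within {a..b})"
    and u': "continuous_on {a..b} u'" and ab: "a \<le> b"
  shows "has_weak_deriv a b u u'"
proof -
  have cu: "continuous_on {a..b} u"
    unfolding continuous_on_eq_continuous_within using u DERIV_continuous by blast
  have "(LINT x:{a<..<b}|lebesgue. u x * deriv \<phi> x) = - (LINT x:{a<..<b}|lebesgue. u' x * \<phi> x)"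
    if "test_function a b \<phi>" for \<phi>
  proof -
    from that obtain K where K: "K \<subseteq> {a<..<b}" "\<And>x. x \<notin> K \<Longrightarrow> \<phi> x = 0"
      and "\<phi> C1_differentiable_on UNIV"
      by (auto simp: test_function_def)
    then obtain D where D: "\<And>x. (\<phi> has_real_derivative D x) (at x)" "continuous_on UNIV D"
      unfolding C1_differentiable_on_def by (auto simp: has_real_derivative_iff_has_vector_derivative)
    have c\<phi>: "continuous_on {a..b} \<phi>" using D(1) by (meson DERIV_isCont continuous_at_imp_continuous_on)
    have cD: "continuous_on {a..b} D" using D(2) continuous_on_subset by blast
    have i1: "(\<lambda>x. u x * D x) absolutely_integrable_on {a<..<b}"
     and i2: "(\<lambda>x. u' x * \<phi> x) absolutely_integrable_on {a<..<b}"
      by (rule set_integrable_subset[of _ "{a..b}"];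
          auto intro!: absolutely_integrable_continuous_real continuous_intros cu c\<phi> cD u')+
    have "((\<lambda>x. u x * D x + u' x * \<phi> x) has_integral (u b * \<phi> b - u a * \<phi> a)) {a..b}"
      by (rule fundamental_theorem_of_calculus[OF ab])
         (auto simp: has_real_derivative_iff_has_vector_derivative[symmetric] algebra_simps
           intro!: derivative_eq_intros u has_field_derivative_at_within[OF D(1)])
    moreover have "\<phi> a = 0" "\<phi> b = 0" using K by (meson greaterThanLessThan_iff less_irrefl subsetD)+
    ultimately have "integral {a<..<b} (\<lambda>x. u x * D x + u' x * \<phi> x) = 0"
      by (auto simp: integral_open_interval_real[symmetric] dest: integral_unique)
    then have "(LINT x:{a<..<b}|lebesgue. u x * D x + u' x * \<phi> x) = 0"
      using set_lebesgue_integral_eq_integral(2)[OF set_integral_add(1)[OF i1 i2]] by simp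
    then show ?thesis using set_integral_add(2)[OF i1 i2] DERIV_imp_deriv[OF D(1)] by simp
  qed
  moreover have "u absolutely_integrable_on {a<..<b}" "u' absolutely_integrable_on {a<..<b}"
    by (rule set_integrable_subset[of _ "{a..b}"]; auto intro!: absolutely_integrable_continuous_real cu u')+
  ultimately show ?thesis by (simp add: has_weak_deriv_def)
qed

section \<open>Lower bounds for maps without a cavity\<close>

text \<open>Condensation of (G) to two lower bounds for h that are convenient to integrate.
  Superlinearity gives an affine minorant of any prescribed slope. The power bound gives a multiple
  of 1/d for d < 1; subtracting 1 makes the bound non-positive for d at least 1, where positivity of
  h is enough.\<close>

lemma growth_condition_compression:
  assumes "growth_condition \<Psi>"
  obtains h K where "K > 0"
    and "\<And>M. M \<ge> 0 \<Longrightarrow> \<exists>D\<ge>0. \<forall>d>0. M * (d - D) \<le> h d"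
    and "\<And>d. d > 0 \<Longrightarrow> K * (1 / d - 1) \<le> h d"
    and "\<And>R v\<^sub>1 v\<^sub>2 v\<^sub>3. R \<in> {0..1} \<Longrightarrow> v\<^sub>1 > 0 \<Longrightarrow> v\<^sub>2 > 0 \<Longrightarrow> v\<^sub>3 > 0 \<Longrightarrow>
           h (v\<^sub>1 * v\<^sub>2 * v\<^sub>3) \<le> \<Psi> R v\<^sub>1 v\<^sub>2 v\<^sub>3"
proof -
  from assms obtain \<phi> h :: "real \<Rightarrow> real" and C \<gamma> K s :: real where G:
    "(\<forall>v>0. \<phi> v > 0) \<and> (\<forall>d>0. h d > 0) \<and>
     strictly_convex_on {0<..} \<phi> \<and> strictly_convex_on {0<..} h \<and>
     C > 0 \<and> 1 < \<gamma> \<and> \<gamma> < 3 \<and> (\<forall>v>0. \<phi> v \<ge> C * v powr \<gamma>) \<and>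
     filterlim (\<lambda>d. h d / d) at_top at_top \<and>
     K > 0 \<and> s \<ge> \<gamma> / (\<gamma> - 1) \<and> (\<forall>d>0. h d \<ge> K * d powr (- s)) \<and>
     (\<forall>R\<in>{0..1}. \<forall>v\<^sub>1>0. \<forall>v\<^sub>2>0. \<forall>v\<^sub>3>0.
        \<Psi> R v\<^sub>1 v\<^sub>2 v\<^sub>3 \<ge> \<phi> v\<^sub>1 + \<phi> v\<^sub>2 + \<phi> v\<^sub>3 + h (v\<^sub>1 * v\<^sub>2 * v\<^sub>3))"
    unfolding growth_condition_def by (elim exE) (rule that)
  from G have \<phi>: "\<And>v. v > 0 \<Longrightarrow> \<phi> v > 0" and h: "\<And>d. d > 0 \<Longrightarrow> h d > 0" and \<gamma>: "1 < \<gamma>"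
    and lim: "filterlim (\<lambda>d. h d / d) at_top at_top"
    and K: "K > 0" "s \<ge> \<gamma> / (\<gamma> - 1)" "\<And>d. d > 0 \<Longrightarrow> h d \<ge> K * d powr (- s)"
    and \<Psi>: "\<And>R v\<^sub>1 v\<^sub>2 v\<^sub>3. R \<in> {0..1} \<Longrightarrow> v\<^sub>1 > 0 \<Longrightarrow> v\<^sub>2 > 0 \<Longrightarrow> v\<^sub>3 > 0 \<Longrightarrow>
        \<Psi> R v\<^sub>1 v\<^sub>2 v\<^sub>3 \<ge> \<phi> v\<^sub>1 + \<phi> v\<^sub>2 + \<phi> v\<^sub>3 + h (v\<^sub>1 * v\<^sub>2 * v\<^sub>3)"
    by simp_all
  show thesis
  proof (rule that[of K h])
    fix M :: real assume M: "M \<ge> 0"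
    from lim obtain D where D: "\<And>d. d \<ge> D \<Longrightarrow> M \<le> h d / d"
      unfolding filterlim_at_top eventually_at_top_linorder by blast
    have "M * (d - max D 0) \<le> h d" if "d > 0" for d
    proof (cases "d \<ge> max D 0")
      case True
      then have "M \<le> h d / d" by (intro D) simp
      then have "M * d \<le> h d" using that by (simp add: field_simps)
      moreover have "M * (d - max D 0) \<le> M * d" using M by (intro mult_left_mono) auto
      ultimately show ?thesis by linarith
    next
      case False
      then have "M * (d - max D 0) \<le> 0" using M by (intro mult_nonneg_nonpos) auto
      with h[OF that] show ?thesis by linarith
    qed
    then show "\<exists>D\<ge>0. \<forall>d>0. M * (d - D) \<le> h d" by (intro exI[of _ "max D 0"]) auto
  next
    fix d :: real assume d: "d > 0"
    show "K * (1 / d - 1) \<le> h d"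
    proof (cases "d \<ge> 1")
      case True
      then have "K * (1 / d - 1) \<le> 0" using K(1) by (intro mult_nonneg_nonpos) auto
      with h[OF d] show ?thesis by linarith
    next
      case False
      \<comment> \<open>The exponent s is thus at least 1, and for d < 1 a larger exponent only
        increases the negative power.\<close>
      have "1 \<le> \<gamma> / (\<gamma> - 1)" using \<gamma> by simp
      with K(2) have "d powr (- 1) \<le> d powr (- s)" using False d by (intro powr_mono') auto
      moreover have "d powr (- 1) = 1 / d" using d by (simp add: powr_minus_divide)
      ultimately have "K * (1 / d - 1) \<le> K * d powr (- s)" using K(1) by (intro mult_left_mono) auto
      with K(3)[OF d] show ?thesis by linarith
    qed
  next
    fix R v\<^sub>1 v\<^sub>2 v\<^sub>3 :: real
    assume "R \<in> {0..1}" "v\<^sub>1 > 0" "v\<^sub>2 > 0" "v\<^sub>3 > 0"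
    with \<Psi>[of R v\<^sub>1 v\<^sub>2 v\<^sub>3] \<phi>[of v\<^sub>1] \<phi>[of v\<^sub>2] \<phi>[of v\<^sub>3]
    show "h (v\<^sub>1 * v\<^sub>2 * v\<^sub>3) \<le> \<Psi> R v\<^sub>1 v\<^sub>2 v\<^sub>3" by simp
  qed (fact K(1))
qed

lemma mass_inside_le:
  assumes "\<And>u. u \<in> {0..R} \<Longrightarrow> \<rho>\<^sub>0 u \<le> k" and "0 \<le> k" "0 \<le> R"
  shows "mass_inside \<rho>\<^sub>0 R \<le> 4 * pi * k / 3 * R ^ 3"
proof -
  have i: "((\<lambda>u. k * u\<^sup>2) has_integral k * R ^ 3 / 3 - k * 0 ^ 3 / 3) {0..R}"
    by (rule fundamental_theorem_of_calculus[OF \<open>0 \<le> R\<close>])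
       (auto simp: has_real_derivative_iff_has_vector_derivative[symmetric] intro!: derivative_eq_intros)
  have ai: "(\<lambda>u. k * u\<^sup>2) absolutely_integrable_on {0..R}"
    by (intro absolutely_integrable_continuous_real continuous_intros)
  have "(LINT u:{0..R}|lebesgue. \<rho>\<^sub>0 u * u\<^sup>2) \<le> (LINT u:{0..R}|lebesgue. k * u\<^sup>2)"
    unfolding set_lebesgue_integral_def
    \<comment> \<open>The density need not be measurable: an integrand that is not integrable has
      integral 0 by default, and the bound still holds because the majorant is non-negative.\<close>
    by (rule integral_mono_AE')
       (use ai assms in \<open>auto simp: set_integrable_def indicator_def intro!: AE_I2 mult_right_mono\<close>)
  also have "\<dots> = k * R ^ 3 / 3"
    using set_lebesgue_integral_eq_integral(2)[OF ai] integral_unique[OF i] by (simp only:) simp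
  finally show ?thesis unfolding mass_inside_def by (simp add: mult.assoc)
qed

section \<open>Monotonicity and integral bounds for admissible maps\<close>

lemma admissibleD:
  assumes "r \<in> admissible \<Phi> lam"
  shows "has_weak_deriv 0 1 r (weak_deriv 0 1 r)"
    and "continuous_on {0..1} r" and "r 1 = lam" and "r 0 \<ge> 0" and "I_mec \<Phi> r < \<infinity>"
    and "AE R in lebesgue. R \<in> {0<..<1} \<longrightarrow> 0 < weak_deriv 0 1 r R"
proof -
  from assms show "continuous_on {0..1} r" "r 1 = lam" "r 0 \<ge> 0" "I_mec \<Phi> r < \<infinity>"
    by (simp_all add: admissible_def)
  from assms have "\<exists>g. has_weak_deriv 0 1 r g" by (simp add: admissible_def W11_def)
  then show "has_weak_deriv 0 1 r (weak_deriv 0 1 r)"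
    unfolding weak_deriv_def by (rule someI_ex)
  from assms show "AE R in lebesgue. R \<in> {0<..<1} \<longrightarrow> 0 < weak_deriv 0 1 r R"
    by (simp add: admissible_def AE_restrict_space_iff)
qed

lemma admissible_has_integral:
  assumes "r \<in> admissible \<Phi> lam" "0 \<le> x" "x \<le> y" "y \<le> 1"
  shows "(weak_deriv 0 1 r has_integral (r y - r x)) {x..y}"
  using has_weak_deriv_imp_has_integral[OF admissibleD(1,2)[OF assms(1)] assms(2-4)] .

text \<open>If the increment were 0, the derivative, positive a.e., would vanish a.e. on an interval
  of positive length. Strictness at 0 makes r positive on (0,1], where the integrands divide by r or
  evaluate \<open>\<Phi>\<close> at r/R.\<close>

lemma admissible_strict_mono:
  assumes r: "r \<in> admissible \<Phi> lam" and xy: "0 \<le> x" "x < y" "y \<le> 1"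
  shows "r x < r y"
proof -
  let ?g = "weak_deriv 0 1 r"
  have gi: "?g absolutely_integrable_on {x<..<y}"
    by (rule set_integrable_subset[of _ "{0<..<1}"])
       (use admissibleD(1)[OF r] xy in \<open>auto simp: has_weak_deriv_def\<close>)
  have eq: "(LINT t:{x<..<y}|lebesgue. ?g t) = r y - r x"
    using set_lebesgue_integral_eq_integral(2)[OF gi] xy
      integral_unique[OF admissible_has_integral[OF r, of x y]]
    by (simp add: integral_open_interval_real)
  have i: "integrable lebesgue (\<lambda>t. indicator {x<..<y} t * ?g t)"
    using gi by (simp add: set_integrable_def)
  have pos: "AE t in lebesgue. t \<in> {x<..<y} \<longrightarrow> 0 < ?g t"
    using admissibleD(6)[OF r] by eventually_elim (use xy in auto)
  then have nn: "AE t in lebesgue. 0 \<le> indicator {x<..<y} t * ?g t"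
    by eventually_elim (auto simp: indicator_def)
  have "0 \<le> (LINT t:{x<..<y}|lebesgue. ?g t)"
    unfolding set_lebesgue_integral_def using nn by (intro integral_nonneg_AE) simp
  moreover have "(LINT t:{x<..<y}|lebesgue. ?g t) \<noteq> 0"
  proof
    assume "(LINT t:{x<..<y}|lebesgue. ?g t) = 0"
    then have "AE t in lebesgue. indicator {x<..<y} t * ?g t = 0"
      using integral_nonneg_eq_0_iff_AE[OF i nn] by (simp add: set_lebesgue_integral_def)
    with pos have "AE t in lebesgue. t \<notin> {x<..<y}"
      by eventually_elim (auto simp: indicator_def)
    then have "emeasure lebesgue {x<..<y} = 0"
      by (subst (asm) AE_iff_measurable[of "{x<..<y}"]) auto
    with xy show False by simp
  qed
  ultimately show ?thesis using eq by simp
qed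

lemma admissible_pos:
  assumes "r \<in> admissible \<Phi> lam" "0 < x" "x \<le> 1"
  shows "0 < r x"
  using admissible_strict_mono[OF assms(1), of 0 x] admissibleD(4)[OF assms(1)] assms(2,3) by simp

text \<open>The minorants of the energy density below all have this form; their integrals depend on
  r only through its values at the two ends.\<close>

lemma admissible_affine_integral:
  assumes r: "r \<in> admissible \<Phi> lam" and xy: "0 \<le> x" "x \<le> y" "y \<le> 1" and p: "continuous_on {x..y} p"
  shows "(\<lambda>t. p t + m * weak_deriv 0 1 r t) absolutely_integrable_on {x<..<y}"
    and "(LINT t:{x<..<y}|lebesgue. p t + m * weak_deriv 0 1 r t) = integral {x..y} p + m * (r y - r x)"
proof -
  have g: "weak_deriv 0 1 r absolutely_integrable_on {x<..<y}"
    by (rule set_integrable_subset[of _ "{0<..<1}"])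
       (use admissibleD(1)[OF r] xy in \<open>auto simp: has_weak_deriv_def\<close>)
  have pi: "p absolutely_integrable_on {x<..<y}"
    by (rule set_integrable_subset[OF absolutely_integrable_continuous_real[OF p]]) auto
  have mg: "(\<lambda>t. m * weak_deriv 0 1 r t) absolutely_integrable_on {x<..<y}"
    using g by simp
  show "(\<lambda>t. p t + m * weak_deriv 0 1 r t) absolutely_integrable_on {x<..<y}"
    by (rule set_integral_add(1)[OF pi mg])
  have "(LINT t:{x<..<y}|lebesgue. p t + m * weak_deriv 0 1 r t) =
      (LINT t:{x<..<y}|lebesgue. p t) + (LINT t:{x<..<y}|lebesgue. m * weak_deriv 0 1 r t)"
    by (rule set_integral_add(2)[OF pi mg])
  also have "\<dots> = integral {x..y} p + m * (r y - r x)"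
    using integral_unique[OF admissible_has_integral[OF r xy]]
    by (simp add: set_lebesgue_integral_eq_integral(2)[OF pi] set_lebesgue_integral_eq_integral(2)[OF g]
        integral_open_interval_real)
  finally show "(LINT t:{x<..<y}|lebesgue. p t + m * weak_deriv 0 1 r t) = integral {x..y} p + m * (r y - r x)" .
qed

text \<open>The minorant f may change sign: its integral is at most that of its positive part, and
  that part is what \<open>ennreal\<close> compares with the energy density.\<close>

lemma I_mec_ge_integral:
  assumes f: "f absolutely_integrable_on S" and S: "S \<subseteq> {0<..<1}"
    and le: "AE R in lebesgue. R \<in> S \<longrightarrow> f R \<le> \<Phi> R (weak_deriv 0 1 r R) (r R / R) (r R / R) * R\<^sup>2"
  shows "ennreal (LINT R:S|lebesgue. f R) \<le> I_mec \<Phi> r"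
proof -
  have i: "integrable lebesgue (\<lambda>R. indicator S R * f R)" using f by (simp add: set_integrable_def)
  have fin: "(\<integral>\<^sup>+R. ennreal (indicator S R * f R) \<partial>lebesgue) < top"
    using i by (simp add: real_integrable_def top.not_eq_extremum)
  have "(LINT R:S|lebesgue. f R) \<le> enn2real (\<integral>\<^sup>+R. ennreal (indicator S R * f R) \<partial>lebesgue)"
    using real_lebesgue_integral_def[OF i] by (simp add: set_lebesgue_integral_def)
  then have "ennreal (LINT R:S|lebesgue. f R) \<le> ennreal (enn2real (\<integral>\<^sup>+R. ennreal (indicator S R * f R) \<partial>lebesgue))"
    by (rule ennreal_leI)
  also have "\<dots> = (\<integral>\<^sup>+R. ennreal (indicator S R * f R) \<partial>lebesgue)"
    by (rule ennreal_enn2real[OF fin])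
  also have "\<dots> \<le> I_mec \<Phi> r"
    unfolding I_mec_def
  proof (rule nn_integral_mono_AE)
    show "AE R in lebesgue. ennreal (indicator S R * f R) \<le>
        ennreal (\<Phi> R (weak_deriv 0 1 r R) (r R / R) (r R / R) * R\<^sup>2) * indicator {0<..<1} R"
      using le
    proof eventually_elim
      case (elim R)
      then show ?case using S by (cases "R \<in> S") (auto simp: ennreal_leI)
    qed
  qed
  finally show ?thesis .
qed

section \<open>Mechanical and potential energy when r(0) = 0\<close>

context
  fixes \<Phi> :: "real \<Rightarrow> real \<Rightarrow> real \<Rightarrow> real \<Rightarrow> real" and h :: "real \<Rightarrow> real"
    and r :: "real \<Rightarrow> real" and lam :: real
  assumes \<Phi>: "\<And>R v\<^sub>1 v\<^sub>2 v\<^sub>3. R \<in> {0..1} \<Longrightarrow> v\<^sub>1 > 0 \<Longrightarrow> v\<^sub>2 > 0 \<Longrightarrow> v\<^sub>3 > 0 \<Longrightarrow>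
      h (v\<^sub>1 * v\<^sub>2 * v\<^sub>3) \<le> \<Phi> R v\<^sub>1 v\<^sub>2 v\<^sub>3"
    and r: "r \<in> admissible \<Phi> lam" and r0: "r 0 = 0"
begin

text \<open>The weight \<open>R\<^sup>2\<close> cancels the denominators of the two factors r/R in
  the volume ratio, so an affine bound on h becomes affine in r' r^2.\<close>

lemma uncavitated_density_ge:
  assumes R: "R \<in> {0<..<1}" and g: "0 < weak_deriv 0 1 r R"
    and h: "\<And>d. d > 0 \<Longrightarrow> c + m * d \<le> h d"
  shows "c * R\<^sup>2 + m * (weak_deriv 0 1 r R * (r R)\<^sup>2) \<le> \<Phi> R (weak_deriv 0 1 r R) (r R / R) (r R / R) * R\<^sup>2"
proof -
  let ?g = "weak_deriv 0 1 r R" and ?d = "weak_deriv 0 1 r R * (r R / R) * (r R / R)"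
  have p: "0 < r R / R" using admissible_pos[OF r, of R] R by simp
  have "c + m * ?d \<le> h ?d" using g p by (intro h mult_pos_pos)
  also have "\<dots> \<le> \<Phi> R ?g (r R / R) (r R / R)" using R g p by (intro \<Phi>) auto
  finally have "(c + m * ?d) * R\<^sup>2 \<le> \<Phi> R ?g (r R / R) (r R / R) * R\<^sup>2" by (rule mult_right_mono) simp
  moreover have "(c + m * ?d) * R\<^sup>2 = c * R\<^sup>2 + m * (?g * (r R)\<^sup>2)"
    using R by (simp add: field_simps power2_eq_square)
  ultimately show ?thesis by simp
qed

lemma uncavitated_I_mec_ge:
  assumes M: "M \<ge> 0" "D \<ge> 0" and h: "\<And>d. d > 0 \<Longrightarrow> M * (d - D) \<le> h d"
  shows "ennreal (M * (lam ^ 3 / 8 - D)) \<le> I_mec \<Phi> r"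
proof -
  have lam: "lam > 0" using admissible_pos[OF r, of 1] admissibleD(3)[OF r] by simp
  \<comment> \<open>The absence of a cavity enters here: r starts at 0 and must pass lambda / 2.
    Beyond x the factor r^2 is at least lambda^2 / 4 while r still gains lambda / 2, which accounts
    for lambda^3 / 8.\<close>
  obtain x where x: "0 \<le> x" "x \<le> 1" "r x = lam / 2"
    using IVT'[of r 0 "lam/2" 1] admissibleD(2,3)[OF r] r0 lam by auto
  let ?f = "\<lambda>t. - (M * D) + M * lam\<^sup>2 / 4 * weak_deriv 0 1 r t"
  have "ennreal (LINT t:{x<..<1}|lebesgue. ?f t) \<le> I_mec \<Phi> r"
  proof (rule I_mec_ge_integral)
    show "?f absolutely_integrable_on {x<..<1}" using x by (intro admissible_affine_integral[OF r]) auto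
    show "AE R in lebesgue. R \<in> {x<..<1} \<longrightarrow> ?f R \<le> \<Phi> R (weak_deriv 0 1 r R) (r R / R) (r R / R) * R\<^sup>2"
      using admissibleD(6)[OF r]
    proof eventually_elim
      case (elim R)
      show ?case
      proof
        assume R: "R \<in> {x<..<1}"
        then have R': "R \<in> {0<..<1}" and g: "0 < weak_deriv 0 1 r R" using x elim by auto
        have "lam / 2 \<le> r R" using admissible_strict_mono[OF r, of x R] x R by simp
        then have "(lam / 2)\<^sup>2 \<le> (r R)\<^sup>2" using lam by (intro power_mono) auto
        then have "M * (weak_deriv 0 1 r R * (lam / 2)\<^sup>2) \<le> M * (weak_deriv 0 1 r R * (r R)\<^sup>2)"
          using g M by (intro mult_left_mono) auto
        moreover have "M * D * R\<^sup>2 \<le> M * D * 1"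
          using M R' by (intro mult_left_mono) (auto simp: power_le_one)
        moreover have "- (M * D) * R\<^sup>2 + M * (weak_deriv 0 1 r R * (r R)\<^sup>2)
            \<le> \<Phi> R (weak_deriv 0 1 r R) (r R / R) (r R / R) * R\<^sup>2"
          by (rule uncavitated_density_ge[OF R' g]) (use h in \<open>simp add: algebra_simps\<close>)
        ultimately show "?f R \<le> \<Phi> R (weak_deriv 0 1 r R) (r R / R) (r R / R) * R\<^sup>2"
          by (simp add: power2_eq_square algebra_simps)
      qed
    qed
  qed (use x in auto)
  moreover have "M * (lam ^ 3 / 8 - D) \<le> (LINT t:{x<..<1}|lebesgue. ?f t)"
  proof -
    have "(LINT t:{x<..<1}|lebesgue. ?f t) = - (M * D) * (1 - x) + M * lam\<^sup>2 / 4 * (lam - lam / 2)"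
      using admissible_affine_integral(2)[OF r, of x 1 "\<lambda>_. - (M * D)" "M * lam\<^sup>2 / 4"] x admissibleD(3)[OF r]
      by (simp add: mult.commute)
    moreover have "M * D * (1 - x) \<le> M * D * 1" using M x by (intro mult_left_mono) auto
    ultimately show ?thesis by (simp add: power2_eq_square power3_eq_cube algebra_simps)
  qed
  ultimately show ?thesis by (rule order_trans[OF ennreal_leI, rotated])
qed

text \<open>Equivalent to a lower bound for r(x) by a multiple of x^2. The energy controls the
  integral of R^2 / d; replacing the convex function 1/d by a tangent line makes the integrand
  affine in r', and r(0) = 0 turns the integral of r' over (0,x) into r(x).\<close>

lemma uncavitated_stretch_le:
  assumes K: "K > 0" and h: "\<And>d. d > 0 \<Longrightarrow> K * (1 / d - 1) \<le> h d" and x: "0 < x" "x < 1"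
  shows "(x / r x) ^ 3 * x ^ 3 \<le> 9 * enn2real (I_mec \<Phi> r) / K + 3"
proof -
  have p: "r x > 0" using admissible_pos[OF r, of x] x by simp
  define \<rho> where "\<rho> = (r x) ^ 3 / x ^ 3"
  \<comment> \<open>the choice of a that makes the tangent bound \<open>1 / d \<ge> 2 / a - d / a\<^sup>2\<close> strongest after integration\<close>
  define a where "a = 3 * \<rho>"
  have \<rho>: "\<rho> > 0" and a: "a > 0" using p x by (auto simp: \<rho>_def a_def)
  let ?f = "\<lambda>t. K * (2 / a - 1) * t\<^sup>2 + (- K / a\<^sup>2 * (r x)\<^sup>2) * weak_deriv 0 1 r t"
  have "ennreal (LINT t:{0<..<x}|lebesgue. ?f t) \<le> I_mec \<Phi> r"
  proof (rule I_mec_ge_integral)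
    show "?f absolutely_integrable_on {0<..<x}" using x by (intro admissible_affine_integral[OF r] continuous_intros) auto
    show "AE R in lebesgue. R \<in> {0<..<x} \<longrightarrow> ?f R \<le> \<Phi> R (weak_deriv 0 1 r R) (r R / R) (r R / R) * R\<^sup>2"
      using admissibleD(6)[OF r]
    proof eventually_elim
      case (elim R)
      show ?case
      proof
        assume R: "R \<in> {0<..<x}"
        then have R': "R \<in> {0<..<1}" and g: "0 < weak_deriv 0 1 r R" using x elim by auto
        have "r R \<le> r x" using admissible_strict_mono[OF r, of R x] x R by simp
        then have "(r R)\<^sup>2 \<le> (r x)\<^sup>2" using admissible_pos[OF r, of R] R' by (intro power_mono) auto
        then have "K / a\<^sup>2 * (weak_deriv 0 1 r R * (r R)\<^sup>2) \<le> K / a\<^sup>2 * (weak_deriv 0 1 r R * (r x)\<^sup>2)"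
          using g K by (intro mult_left_mono) auto
        moreover have "K * (2 / a - 1) * R\<^sup>2 + - K / a\<^sup>2 * (weak_deriv 0 1 r R * (r R)\<^sup>2)
            \<le> \<Phi> R (weak_deriv 0 1 r R) (r R / R) (r R / R) * R\<^sup>2"
        proof (rule uncavitated_density_ge[OF R' g])
          fix d :: real assume d: "d > 0"
          have "2 / a - d / a\<^sup>2 \<le> 1 / d"
          proof -
            have "0 \<le> (d - a)\<^sup>2 / (a\<^sup>2 * d)" using d by simp
            also have "\<dots> = 1 / d - (2 / a - d / a\<^sup>2)"
              using d a by (simp add: field_simps power2_eq_square)
            finally show ?thesis by simp
          qed
          then have "K * (2 / a - d / a\<^sup>2 - 1) \<le> K * (1 / d - 1)" using K by (intro mult_left_mono) auto
          with h[OF d] show "K * (2 / a - 1) + - K / a\<^sup>2 * d \<le> h d" by (simp add: algebra_simps)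
        qed
        ultimately show "?f R \<le> \<Phi> R (weak_deriv 0 1 r R) (r R / R) (r R / R) * R\<^sup>2"
          by (simp add: algebra_simps)
      qed
    qed
  qed (use x in auto)
  also have "I_mec \<Phi> r = ennreal (enn2real (I_mec \<Phi> r))"
    using admissibleD(5)[OF r] by simp
  finally have "(LINT t:{0<..<x}|lebesgue. ?f t) \<le> enn2real (I_mec \<Phi> r)"
    by (simp add: ennreal_le_iff)
  moreover have "(LINT t:{0<..<x}|lebesgue. ?f t) = K * (2 / a - 1) * (x ^ 3 / 3) - K / a\<^sup>2 * (r x) ^ 3"
  proof -
    have "((\<lambda>t. K * (2 / a - 1) * t\<^sup>2) has_integral K * (2 / a - 1) * x ^ 3 / 3 - K * (2 / a - 1) * 0 ^ 3 / 3) {0..x}"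
      using x by (intro fundamental_theorem_of_calculus)
       (auto simp: has_real_derivative_iff_has_vector_derivative[symmetric] intro!: derivative_eq_intros)
    then have i: "integral {0..x} (\<lambda>t. K * (2 / a - 1) * t\<^sup>2) = K * (2 / a - 1) * (x ^ 3 / 3)"
      by (simp only: integral_unique) simp
    have "(LINT t:{0<..<x}|lebesgue. ?f t) =
        integral {0..x} (\<lambda>t. K * (2 / a - 1) * t\<^sup>2) + (- K / a\<^sup>2 * (r x)\<^sup>2) * (r x - r 0)"
      using x by (intro admissible_affine_integral(2)[OF r] continuous_intros) auto
    then show ?thesis unfolding i r0 by (simp add: power2_eq_square power3_eq_cube)
  qed
  \<comment> \<open>For \<open>a = 3 * \<rho>\<close> the tangent line contributes 2/9 - 1/9 = 1/9
    of \<open>K * x ^ 3 / \<rho>\<close>, the origin of the factor 9; the constant 3 comes from the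
    remaining \<open>K * x ^ 3 / 3\<close>.\<close>
  moreover have "K * (2 / a - 1) * (x ^ 3 / 3) - K / a\<^sup>2 * (r x) ^ 3 = K * x ^ 3 / (9 * \<rho>) - K * x ^ 3 / 3"
  proof -
    have "(r x) ^ 3 = \<rho> * x ^ 3" using x by (simp add: \<rho>_def)
    then show ?thesis using \<rho> by (simp add: a_def field_simps power2_eq_square)
  qed
  moreover have "K * x ^ 3 / (9 * \<rho>) = K / 9 * ((x / r x) ^ 3 * x ^ 3)"
    using p x by (simp add: \<rho>_def field_simps power_divide)
  moreover have "K * x ^ 3 \<le> K * 1" using K x by (intro mult_left_mono) (auto simp: power_le_one)
  ultimately have "K / 9 * ((x / r x) ^ 3 * x ^ 3) \<le> enn2real (I_mec \<Phi> r) + K / 3" by linarith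
  then show ?thesis using K by (simp add: field_simps)
qed

end

text \<open>With t = R/r the integrand is at most a constant times R^4 t, and the stretch estimate
  bounds R^3 t^3 by the energy. Since t enters only to the first power, the coefficient of the
  energy can be made small by a large m. The bound is pointwise and the interval has length 1, so it
  passes to the integral.\<close>

lemma uncavitated_I_pot_le:
  assumes \<Phi>: "\<And>R v\<^sub>1 v\<^sub>2 v\<^sub>3. R \<in> {0..1} \<Longrightarrow> v\<^sub>1 > 0 \<Longrightarrow> v\<^sub>2 > 0 \<Longrightarrow> v\<^sub>3 > 0 \<Longrightarrow>
      h (v\<^sub>1 * v\<^sub>2 * v\<^sub>3) \<le> \<Phi> R v\<^sub>1 v\<^sub>2 v\<^sub>3"
    and r: "r \<in> admissible \<Phi> lam" and r0: "r 0 = 0"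
    and K: "K > 0" and h: "\<And>d. d > 0 \<Longrightarrow> K * (1 / d - 1) \<le> h d"
    and \<rho>: "\<And>R. R \<in> {0..1} \<Longrightarrow> 0 \<le> \<rho>\<^sub>0 R \<and> \<rho>\<^sub>0 R \<le> k" and m: "m > 0"
  shows "I_pot \<rho>\<^sub>0 r \<le> ennreal (4 * pi * k\<^sup>2 / 3 * ((9 * enn2real (I_mec \<Phi> r) / K + 3) / m\<^sup>2 + m))"
    (is "_ \<le> ennreal (?B * (?X / _ + _))")
proof -
  have k: "0 \<le> k" using \<rho>[of 0] by simp
  have "\<rho>\<^sub>0 R * (mass_inside \<rho>\<^sub>0 R / r R) * R\<^sup>2 \<le> ?B * (?X / m\<^sup>2 + m)" if R: "R \<in> {0<..<1}" for R
  proof -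
    have p: "r R > 0" using admissible_pos[OF r] R by simp
    define t where "t = R / r R"
    have t: "t > 0" using p R by (simp add: t_def)
    have "mass_inside \<rho>\<^sub>0 R \<le> 4 * pi * k / 3 * R ^ 3"
      using \<rho> R k by (intro mass_inside_le) auto
    then have "mass_inside \<rho>\<^sub>0 R / r R \<le> 4 * pi * k / 3 * R ^ 3 / r R"
      using p by (intro divide_right_mono) auto
    then have "\<rho>\<^sub>0 R * (mass_inside \<rho>\<^sub>0 R / r R) \<le> \<rho>\<^sub>0 R * (4 * pi * k / 3 * R ^ 3 / r R)"
      using \<rho>[of R] R by (intro mult_left_mono) auto
    also have "\<dots> \<le> k * (4 * pi * k / 3 * R ^ 3 / r R)"
      using \<rho>[of R] R k p by (intro mult_right_mono) auto
    finally have "\<rho>\<^sub>0 R * (mass_inside \<rho>\<^sub>0 R / r R) * R\<^sup>2 \<le> k * (4 * pi * k / 3 * R ^ 3 / r R) * R\<^sup>2"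
      by (rule mult_right_mono) simp
    also have "\<dots> = ?B * (R ^ 4 * t)"
      by (simp add: t_def eval_nat_numeral)
    also have "\<dots> \<le> ?B * (?X / m\<^sup>2 + m)"
    proof (rule mult_left_mono)
      have "t \<le> t ^ 3 / m\<^sup>2 + m"
      proof (cases "t \<le> m")
        case True
        then show ?thesis using t by (simp add: add_increasing)
      next
        case False
        then have "t * m\<^sup>2 \<le> t * t\<^sup>2" using m t by (intro mult_left_mono power_mono) auto
        then have "t \<le> t ^ 3 / m\<^sup>2" using m by (simp add: field_simps power2_eq_square power3_eq_cube)
        then show ?thesis using m by simp
      qed
      then have "R ^ 4 * t \<le> R ^ 4 * (t ^ 3 / m\<^sup>2 + m)" using R by (intro mult_left_mono) auto
      also have "\<dots> = R * (t ^ 3 * R ^ 3 / m\<^sup>2) + R ^ 4 * m"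
        by (simp add: algebra_simps eval_nat_numeral)
      also have "\<dots> \<le> 1 * (t ^ 3 * R ^ 3 / m\<^sup>2) + 1 * m"
        using R t m by (intro add_mono mult_right_mono) (auto simp: power_le_one)
      also have "t ^ 3 * R ^ 3 \<le> ?X"
        unfolding t_def using uncavitated_stretch_le[OF \<Phi> r r0 K h, of R] R by simp
      finally show "R ^ 4 * t \<le> ?X / m\<^sup>2 + m" by (simp add: divide_right_mono)
    qed simp
    finally show ?thesis .
  qed
  then have "I_pot \<rho>\<^sub>0 r \<le> (\<integral>\<^sup>+R. ennreal (?B * (?X / m\<^sup>2 + m)) * indicator {0<..<1::real} R \<partial>lebesgue)"
    unfolding I_pot_def by (intro nn_integral_mono) (auto simp: indicator_def intro: ennreal_leI)
  also have "\<dots> = ennreal (?B * (?X / m\<^sup>2 + m))"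
    by (subst nn_integral_cmult_indicator) auto
  finally show ?thesis .
qed

section \<open>The incompressible cavitating map\<close>

text \<open>The solution of r' r^2 = R^2 whose cavity has radius \<open>root 3 A\<close>; it is used
  with \<open>A = lam ^ 3 - 1\<close>, which gives the boundary value \<open>lam\<close>.\<close>

definition cavity_map :: "real \<Rightarrow> real \<Rightarrow> real" where
  "cavity_map A R = root 3 (R ^ 3 + A)"

context
  fixes A :: real
  assumes A: "A > 0"
begin

lemma cavity_map_pos: "R \<ge> 0 \<Longrightarrow> cavity_map A R > 0"
  and cavity_map_cubed: "R \<ge> 0 \<Longrightarrow> cavity_map A R ^ 3 = R ^ 3 + A"
  using A by (simp_all add: cavity_map_def add_nonneg_pos)

lemma cavity_map_has_derivative:
  assumes "R \<ge> 0"
  shows "(cavity_map A has_real_derivative R\<^sup>2 / (cavity_map A R)\<^sup>2) (at R within S)"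
proof -
  have root: "(root 3 has_real_derivative inverse (3 * cavity_map A R ^ 2)) (at (R ^ 3 + A))"
    using DERIV_real_root[of 3 "R ^ 3 + A"] A assms
    by (simp add: cavity_map_def add_nonneg_pos numeral_2_eq_2)
  have "((\<lambda>R. root 3 (R ^ 3 + A)) has_real_derivative inverse (3 * (cavity_map A R)\<^sup>2) * (3 * R\<^sup>2)) (at R within S)"
    by (rule DERIV_chain2[where g = "\<lambda>R. R ^ 3 + A", OF root]) (auto intro!: derivative_eq_intros)
  moreover have "inverse (3 * (cavity_map A R)\<^sup>2) * (3 * R\<^sup>2) = R\<^sup>2 / (cavity_map A R)\<^sup>2"
    by (simp add: divide_simps)
  moreover have "(\<lambda>R. root 3 (R ^ 3 + A)) = cavity_map A" by (simp add: cavity_map_def fun_eq_iff)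
  ultimately show ?thesis by simp
qed

text \<open>Although the cube root is not differentiable at 0, A > 0 keeps its argument away from 0,
  so the map is C^1 up to R = 0.\<close>

lemma cavity_map_has_weak_deriv:
  "has_weak_deriv 0 1 (cavity_map A) (\<lambda>R. R\<^sup>2 / (cavity_map A R)\<^sup>2)"
proof (rule C1_imp_has_weak_deriv)
  show "continuous_on {0..1} (\<lambda>R. R\<^sup>2 / (cavity_map A R)\<^sup>2)"
    unfolding cavity_map_def using A by (intro continuous_intros) (auto simp: add_nonneg_eq_0_iff)
qed (auto intro: cavity_map_has_derivative)

lemma AE_weak_deriv_cavity_map:
  "AE R in lebesgue. R \<in> {0<..<1} \<longrightarrow>
     weak_deriv 0 1 (cavity_map A) R = R\<^sup>2 / (cavity_map A R)\<^sup>2"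
proof (rule has_weak_deriv_unique[OF _ cavity_map_has_weak_deriv])
  show "has_weak_deriv 0 1 (cavity_map A) (weak_deriv 0 1 (cavity_map A))"
    using someI[of "has_weak_deriv 0 1 (cavity_map A)", OF cavity_map_has_weak_deriv]
    by (simp add: weak_deriv_def)
  show "continuous_on {0..1} (cavity_map A)"
    unfolding cavity_map_def by (intro continuous_intros)
qed

section \<open>The stretch r(R)/R as integration variable\<close>

lemma cavity_map_stretch_cubed: "R > 0 \<Longrightarrow> (cavity_map A R / R) ^ 3 = 1 + A / R ^ 3"
  by (simp add: power_divide cavity_map_cubed add_divide_distrib)

lemma cavity_map_stretch_image:
  assumes lam: "lam > 0" "lam ^ 3 = 1 + A"
  shows "(\<lambda>R. cavity_map A R / R) ` {0<..<1} = {lam<..}"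
proof (intro set_eqI iffI)
  fix w assume "w \<in> (\<lambda>R. cavity_map A R / R) ` {0<..<1}"
  then obtain R where R: "0 < R" "R < 1" and w: "w = cavity_map A R / R" by auto
  have "A < A / R ^ 3" using R A by (simp add: less_divide_eq power_less_one_iff)
  then have "lam ^ 3 < w ^ 3" using cavity_map_stretch_cubed[OF R(1)] w lam by simp
  moreover have "0 \<le> w" using w R cavity_map_pos[of R] by simp
  ultimately have "lam < w" by (rule power_less_imp_less_base)
  then show "w \<in> {lam<..}" by simp
next
  fix w assume "w \<in> {lam<..}"
  then have w: "lam < w" by simp
  have "lam ^ 3 < w ^ 3" using w lam by (intro power_strict_mono) auto
  then have wA: "A < w ^ 3 - 1" using lam by simp
  \<comment> \<open>The solution of \<open>1 + A / R ^ 3 = w ^ 3\<close>.\<close>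
  define R where "R = root 3 (A / (w ^ 3 - 1))"
  have R3: "R ^ 3 = A / (w ^ 3 - 1)" and R0: "R > 0" using wA A by (auto simp: R_def)
  have "R ^ 3 < 1" using R3 wA A by simp
  then have R1: "R < 1" using R0 by (simp add: power_less_one_iff)
  have "(cavity_map A R / R) ^ 3 = w ^ 3"
    using cavity_map_stretch_cubed[OF R0] R3 wA A by simp
  then have "w = cavity_map A R / R"
    using w lam R0 cavity_map_pos[of R] by (metis divide_nonneg_nonneg less_imp_le less_trans power_eq_iff_eq_base zero_less_numeral)
  then show "w \<in> (\<lambda>R. cavity_map A R / R) ` {0<..<1}" using R0 R1 by auto
qed

text \<open>Explains the weight in the integrability hypothesis. For v = r/R one has v^3 - 1 = A /
  R^3 and |dv/dR| = A / (r^2 R^2), so \<open>v\<^sup>2 / (v ^ 3 - 1)\<^sup>2\<close> dv is R^2 dR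
  divided by A.\<close>

lemma cavity_map_change_of_variables:
  fixes f :: "real \<Rightarrow> real"
  assumes lam: "lam > 0" "lam ^ 3 = 1 + A"
    and f: "(\<lambda>v. v\<^sup>2 / (v ^ 3 - 1)\<^sup>2 * f v) absolutely_integrable_on {lam<..}"
  shows "(\<lambda>R. f (cavity_map A R / R) * R\<^sup>2) absolutely_integrable_on {0<..<1}"
    and "integral {0<..<1} (\<lambda>R. f (cavity_map A R / R) * R\<^sup>2) =
      A * integral {lam<..} (\<lambda>v. v\<^sup>2 / (v ^ 3 - 1)\<^sup>2 * f v)"
proof -
  let ?v = "\<lambda>R. cavity_map A R / R" and ?F = "\<lambda>v. v\<^sup>2 / (v ^ 3 - 1)\<^sup>2 * f v"
  let ?d = "\<lambda>R. - A / ((cavity_map A R)\<^sup>2 * R\<^sup>2)"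
  have der: "(?v has_field_derivative ?d R) (at R within {0<..<1})" if "R \<in> {0<..<1}" for R
  proof (rule DERIV_cong[OF DERIV_divide[OF cavity_map_has_derivative DERIV_ident]])
    have p: "cavity_map A R > 0" using cavity_map_pos[of R] that by simp
    have c: "cavity_map A R * cavity_map A R * cavity_map A R = R * R * R + A"
      using cavity_map_cubed[of R] that by (simp add: power3_eq_cube)
    have "R\<^sup>2 / (cavity_map A R)\<^sup>2 * R - cavity_map A R * 1 = (R * R * R - cavity_map A R * cavity_map A R * cavity_map A R) / (cavity_map A R)\<^sup>2"
      using p by (simp add: field_simps power2_eq_square)
    also have "\<dots> = - A / (cavity_map A R)\<^sup>2" unfolding c by simp
    finally show "(R\<^sup>2 / (cavity_map A R)\<^sup>2 * R - cavity_map A R * 1) / (R * R) = ?d R"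
      by (simp add: power2_eq_square)
  qed (use that in auto)
  have inj: "inj_on ?v {0<..<1}"
  proof (rule inj_onI)
    fix x y :: real assume xy: "x \<in> {0<..<1}" "y \<in> {0<..<1}" "?v x = ?v y"
    then have "1 + A / x ^ 3 = 1 + A / y ^ 3"
      by (metis cavity_map_stretch_cubed greaterThanLessThan_iff)
    then have "x ^ 3 = y ^ 3" using A xy by (simp add: field_simps)
    then show "x = y" using xy by (simp add: power_eq_iff_eq_base)
  qed
  have eq: "\<bar>?d R\<bar> * ?F (?v R) = (1 / A) * (f (?v R) * R\<^sup>2)" if "R \<in> {0<..<1}" for R
  proof -
    have p: "cavity_map A R > 0" using cavity_map_pos[of R] that by simp
    have "?v R ^ 3 - 1 = A / R ^ 3" using cavity_map_stretch_cubed[of R] that by simp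
    then have "\<bar>?d R\<bar> * ?F (?v R) = A / ((cavity_map A R)\<^sup>2 * R\<^sup>2) * ((?v R)\<^sup>2 / (A / R ^ 3)\<^sup>2 * f (?v R))"
      using A by simp
    also have "\<dots> = (1 / A) * (f (?v R) * R\<^sup>2)"
      using p A that by (simp add: field_simps power_divide eval_nat_numeral)
    finally show ?thesis .
  qed
  have "(\<lambda>R. \<bar>?d R\<bar> * ?F (?v R)) absolutely_integrable_on {0<..<1} \<and>
      integral {0<..<1} (\<lambda>R. \<bar>?d R\<bar> * ?F (?v R)) = integral {lam<..} ?F"
    using has_absolute_integral_change_of_variables_1'[OF _ der inj, of ?F "integral {lam<..} ?F"] f
    by (simp only: cavity_map_stretch_image[OF lam]) simp
  moreover have "(\<lambda>R. \<bar>?d R\<bar> * ?F (?v R)) absolutely_integrable_on {0<..<1} \<longleftrightarrow>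
      (\<lambda>R. (1 / A) * (f (?v R) * R\<^sup>2)) absolutely_integrable_on {0<..<1}"
    by (rule set_integrable_cong; (rule refl | erule eq))
  moreover have "integral {0<..<1} (\<lambda>R. \<bar>?d R\<bar> * ?F (?v R)) = integral {0<..<1} (\<lambda>R. (1 / A) * (f (?v R) * R\<^sup>2))"
    by (rule Henstock_Kurzweil_Integration.integral_cong) (erule eq)
  ultimately have *: "(\<lambda>R. (1 / A) * (f (?v R) * R\<^sup>2)) absolutely_integrable_on {0<..<1}"
      "integral {0<..<1} (\<lambda>R. (1 / A) * (f (?v R) * R\<^sup>2)) = integral {lam<..} ?F"
    by metis+
  have A0: "1 / A \<noteq> 0" using A by simp
  show "(\<lambda>R. f (?v R) * R\<^sup>2) absolutely_integrable_on {0<..<1}"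
    using *(1) set_integrable_mult_right_iff[OF A0] by blast
  show "integral {0<..<1} (\<lambda>R. f (?v R) * R\<^sup>2) = A * integral {lam<..} ?F"
    using *(2) A by (simp add: field_simps)
qed

end

text \<open>Along this map r' = (R/r)^2, so the principal stretches are 1/v^2, v, v with v = r/R,
  exactly the arguments in the integrability hypothesis. The energy estimate also supplies the
  finiteness that admissibility asks for.\<close>

lemma cavity_map_admissible:
  assumes \<Phi>t: "\<And>v\<^sub>1 v\<^sub>2 v\<^sub>3. v\<^sub>1 > 0 \<Longrightarrow> v\<^sub>2 > 0 \<Longrightarrow> v\<^sub>3 > 0 \<Longrightarrow> 0 \<le> \<Phi>t v\<^sub>1 v\<^sub>2 v\<^sub>3"
    and \<Phi>: "\<And>R v\<^sub>1 v\<^sub>2 v\<^sub>3. R \<in> {0..1} \<Longrightarrow> v\<^sub>1 > 0 \<Longrightarrow> v\<^sub>2 > 0 \<Longrightarrow> v\<^sub>3 > 0 \<Longrightarrow>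
      \<Phi> R v\<^sub>1 v\<^sub>2 v\<^sub>3 \<le> c * \<Phi>t v\<^sub>1 v\<^sub>2 v\<^sub>3"
    and c: "c > 0"
    and int: "(\<lambda>v. v\<^sup>2 / (v ^ 3 - 1)\<^sup>2 * \<Phi>t (1 / v\<^sup>2) v v) absolutely_integrable_on {lam<..}"
    and lam: "lam > 1"
  shows "I_mec \<Phi> (cavity_map (lam ^ 3 - 1)) \<le>
      ennreal (c * (lam ^ 3 - 1) * integral {lam<..} (\<lambda>v. v\<^sup>2 / (v ^ 3 - 1)\<^sup>2 * \<Phi>t (1 / v\<^sup>2) v v))"
    and "cavity_map (lam ^ 3 - 1) \<in> admissible \<Phi> lam"
proof -
  define A where "A = lam ^ 3 - 1"
  let ?q = "cavity_map A"
  let ?f = "\<lambda>v. \<Phi>t (1 / v\<^sup>2) v v"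
  let ?I = "integral {lam<..} (\<lambda>v. v\<^sup>2 / (v ^ 3 - 1)\<^sup>2 * ?f v)"
  have A: "A > 0" using lam by (simp add: A_def)
  have lA: "lam > 0" "lam ^ 3 = 1 + A" using lam by (auto simp: A_def)
  note cv = cavity_map_change_of_variables[OF A lA int]
  have "I_mec \<Phi> ?q \<le> (\<integral>\<^sup>+R. ennreal (c * (indicator {0<..<1} R * (?f (?q R / R) * R\<^sup>2))) \<partial>lebesgue)"
    unfolding I_mec_def
  proof (rule nn_integral_mono_AE)
    show "AE R in lebesgue. ennreal (\<Phi> R (weak_deriv 0 1 ?q R) (?q R / R) (?q R / R) * R\<^sup>2) * indicator {0<..<1} R
        \<le> ennreal (c * (indicator {0<..<1} R * (?f (?q R / R) * R\<^sup>2)))"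
      using AE_weak_deriv_cavity_map[OF A]
    proof eventually_elim
      case (elim R)
      show ?case
      proof (cases "R \<in> {0<..<1}")
        case True
        have p: "?q R > 0" using cavity_map_pos[OF A, of R] True by simp
        have "weak_deriv 0 1 ?q R = 1 / (?q R / R)\<^sup>2" using elim True by (simp add: power_divide)
        moreover have "0 < 1 / (?q R / R)\<^sup>2" "0 < ?q R / R" using p True by simp_all
        ultimately have "\<Phi> R (weak_deriv 0 1 ?q R) (?q R / R) (?q R / R) \<le> c * ?f (?q R / R)"
          using \<Phi>[of R "1 / (?q R / R)\<^sup>2" "?q R / R" "?q R / R"] True by simp
        then have "\<Phi> R (weak_deriv 0 1 ?q R) (?q R / R) (?q R / R) * R\<^sup>2 \<le> c * ?f (?q R / R) * R\<^sup>2"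
          by (rule mult_right_mono) simp
        then show ?thesis using True by (simp add: ennreal_leI mult.assoc)
      qed simp
    qed
  qed
  also have "\<dots> = ennreal (LINT R|lebesgue. c * (indicator {0<..<1} R * (?f (?q R / R) * R\<^sup>2)))"
  proof (rule nn_integral_eq_integral)
    show "integrable lebesgue (\<lambda>R. c * (indicator {0<..<1} R * (?f (?q R / R) * R\<^sup>2)))"
      using cv(1) by (simp add: set_integrable_def)
    have "0 \<le> ?f (?q R / R)" if "R \<in> {0<..<1}" for R
      using cavity_map_pos[OF A, of R] that by (intro \<Phi>t) auto
    then show "AE R in lebesgue. 0 \<le> c * (indicator {0<..<1} R * (?f (?q R / R) * R\<^sup>2))"
      using c by (intro AE_I2) (auto simp: indicator_def)
  qed
  also have "(LINT R|lebesgue. c * (indicator {0<..<1} R * (?f (?q R / R) * R\<^sup>2))) = c * A * ?I"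
    using set_lebesgue_integral_eq_integral(2)[OF cv(1)] cv(2)
    by (simp add: set_lebesgue_integral_def)
  finally have le: "I_mec \<Phi> ?q \<le> ennreal (c * A * ?I)" .
  then show "I_mec \<Phi> (cavity_map (lam ^ 3 - 1)) \<le> ennreal (c * (lam ^ 3 - 1) * ?I)"
    by (simp add: A_def)
  have "AE R in lebesgue. R \<in> {0<..<1} \<longrightarrow> 0 < weak_deriv 0 1 ?q R"
    using AE_weak_deriv_cavity_map[OF A]
  proof eventually_elim
    case (elim R)
    then show ?case using cavity_map_pos[OF A, of R] by auto
  qed
  moreover have "continuous_on {0..1} ?q" unfolding cavity_map_def by (intro continuous_intros)
  moreover have "?q 1 = lam" using lam by (simp add: cavity_map_def A_def real_root_power_cancel)
  moreover have "?q \<in> W11 0 1" using cavity_map_has_weak_deriv[OF A] by (auto simp: W11_def)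
  moreover have "0 \<le> ?q 0" using cavity_map_pos[OF A, of 0] by simp
  moreover have "I_mec \<Phi> ?q < \<infinity>" using le by (rule le_less_trans) simp
  ultimately have "?q \<in> admissible \<Phi> lam" by (simp add: admissible_def AE_restrict_space_iff)
  then show "cavity_map (lam ^ 3 - 1) \<in> admissible \<Phi> lam" by (simp add: A_def)
qed

section \<open>Cavitation for large boundary displacement\<close>

theorem theorem4p1:
  fixes \<Phi> :: "real \<Rightarrow> real \<Rightarrow> real \<Rightarrow> real \<Rightarrow> real"
    and \<Phi>t :: "real \<Rightarrow> real \<Rightarrow> real \<Rightarrow> real"
    and \<rho>\<^sub>0 :: "real \<Rightarrow> real"
    and k\<^sub>0 k\<^sub>1 c\<^sub>0 c\<^sub>1 :: real
  assumes "0 < k\<^sub>0" and "0 < k\<^sub>1"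
    and "\<forall>R\<in>{0..1}. k\<^sub>0 \<le> \<rho>\<^sub>0 R \<and> \<rho>\<^sub>0 R \<le> k\<^sub>1"
    and "\<forall>R\<in>{0..1}. \<forall>v\<^sub>1>0. \<forall>v\<^sub>2>0. \<forall>v\<^sub>3>0. \<Phi> R v\<^sub>1 v\<^sub>2 v\<^sub>3 \<ge> 0"
    and "\<forall>R\<in>{0..1}. symmetric3 (\<Phi> R)"
    and "growth_condition \<Phi>"
    and "0 < c\<^sub>0" and "0 < c\<^sub>1"
    and "\<forall>v\<^sub>1>0. \<forall>v\<^sub>2>0. \<forall>v\<^sub>3>0. \<Phi>t v\<^sub>1 v\<^sub>2 v\<^sub>3 \<ge> 0"
    and "symmetric3 \<Phi>t"
    and "growth_condition (\<lambda>R. \<Phi>t)"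
    and "\<forall>\<eta>>1. (\<lambda>v. v\<^sup>2 / (v ^ 3 - 1)\<^sup>2 * \<Phi>t (1 / v\<^sup>2) v v) absolutely_integrable_on {\<eta><..}"
    and "\<forall>R\<in>{0..1}. \<forall>v\<^sub>1>0. \<forall>v\<^sub>2>0. \<forall>v\<^sub>3>0.
           c\<^sub>0 * \<Phi>t v\<^sub>1 v\<^sub>2 v\<^sub>3 \<le> \<Phi> R v\<^sub>1 v\<^sub>2 v\<^sub>3 \<and> \<Phi> R v\<^sub>1 v\<^sub>2 v\<^sub>3 \<le> c\<^sub>1 * \<Phi>t v\<^sub>1 v\<^sub>2 v\<^sub>3"
  shows "\<exists>lam_star>0. \<forall>lam\<ge>lam_star. \<forall>r\<in>admissible \<Phi> lam.
           energy \<Phi> \<rho>\<^sub>0 r = (INF q\<in>admissible \<Phi> lam. energy \<Phi> \<rho>\<^sub>0 q) \<longrightarrow> r 0 > 0"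
proof -
  have \<Phi>0: "0 \<le> \<Phi>t v\<^sub>1 v\<^sub>2 v\<^sub>3" if "v\<^sub>1 > 0" "v\<^sub>2 > 0" "v\<^sub>3 > 0" for v\<^sub>1 v\<^sub>2 v\<^sub>3
    using assms(9) that by blast
  have \<Phi>1: "\<Phi> R v\<^sub>1 v\<^sub>2 v\<^sub>3 \<le> c\<^sub>1 * \<Phi>t v\<^sub>1 v\<^sub>2 v\<^sub>3"
    if "R \<in> {0..1}" "v\<^sub>1 > 0" "v\<^sub>2 > 0" "v\<^sub>3 > 0" for R v\<^sub>1 v\<^sub>2 v\<^sub>3
    using assms(13) that by blast
  have \<rho>: "0 \<le> \<rho>\<^sub>0 R \<and> \<rho>\<^sub>0 R \<le> k\<^sub>1" if "R \<in> {0..1}" for R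
    using assms(1,3) that by fastforce
  obtain h K where K: "K > 0"
    and hM: "\<And>M. M \<ge> 0 \<Longrightarrow> \<exists>D\<ge>0. \<forall>d>0. M * (d - D) \<le> h d"
    and hK: "\<And>d. d > 0 \<Longrightarrow> K * (1 / d - 1) \<le> h d"
    and h: "\<And>R v\<^sub>1 v\<^sub>2 v\<^sub>3. R \<in> {0..1} \<Longrightarrow> v\<^sub>1 > 0 \<Longrightarrow> v\<^sub>2 > 0 \<Longrightarrow> v\<^sub>3 > 0 \<Longrightarrow>
      h (v\<^sub>1 * v\<^sub>2 * v\<^sub>3) \<le> \<Phi> R v\<^sub>1 v\<^sub>2 v\<^sub>3"
    using growth_condition_compression[OF assms(6)] by metis
  let ?F = "\<lambda>v. v\<^sup>2 / (v ^ 3 - 1)\<^sup>2 * \<Phi>t (1 / v\<^sup>2) v v"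
  define Q where "Q = integral {2<..} ?F"
  have F2: "?F absolutely_integrable_on {2<..}" using assms(12) by simp
  have F0: "0 \<le> ?F v" if "v > 0" for v using \<Phi>0[of "1 / v\<^sup>2" v v] that by simp
  have Q: "Q \<ge> 0"
    unfolding Q_def by (rule Henstock_Kurzweil_Integration.integral_nonneg)
      (use set_lebesgue_integral_eq_integral(1)[OF F2] F0 in auto)
  \<comment> \<open>The mechanical energy is at least M lambda^3 / 8 up to a constant, and half of
    it is spent on the potential energy. The factor 16 leaves \<open>c\<^sub>1 * Q + 1\<close> times
    lambda^3, one lambda^3 more than the bound for the cavitating map.\<close>
  define M where "M = 16 * (c\<^sub>1 * Q + 1)"
  have M: "M \<ge> 0" using Q assms(8) by (simp add: M_def)
  obtain D where D: "D \<ge> 0" "\<And>d. d > 0 \<Longrightarrow> M * (d - D) \<le> h d" using hM[OF M] by blast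
  define B where "B = 4 * pi * k\<^sub>1\<^sup>2 / 3"
  have B: "B > 0" using assms(2) by (simp add: B_def)
  \<comment> \<open>Chosen so that \<open>B * (9 * E / K) / m\<^sup>2\<close> equals E / 2; the
    terms without E then add up to the constant C.\<close>
  define m where "m = sqrt (18 * B / K)"
  have m: "m > 0" and m2: "m\<^sup>2 = 18 * B / K" using B K by (auto simp: m_def)
  define C where "C = K / 6 + B * m"
  have "0 \<le> C" using K B m by (simp add: C_def)
  \<comment> \<open>The bound 2 places {lam<..} inside {2<..}, so the single constant Q serves every
    lambda. The other bound contradicts the final inequality, because lambda is at most
    lambda^3.\<close>
  define lam_star where "lam_star = max 2 (M * D / 2 + C + 1)"
  show ?thesis
  proof (intro exI[of _ lam_star] conjI allI impI ballI)
    show "lam_star > 0" by (simp add: lam_star_def)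
    fix lam r
    assume "lam_star \<le> lam" and r: "r \<in> admissible \<Phi> lam"
      and min: "energy \<Phi> \<rho>\<^sub>0 r = (INF q\<in>admissible \<Phi> lam. energy \<Phi> \<rho>\<^sub>0 q)"
    then have lam: "lam \<ge> 2" "lam > M * D / 2 + C" by (auto simp: lam_star_def)
    have Fl: "?F absolutely_integrable_on {lam<..}" using assms(12) lam by simp
    have lam1: "lam > 1" using lam by simp
    note cav = cavity_map_admissible[where \<Phi>t = \<Phi>t and \<Phi> = \<Phi> and c = c\<^sub>1 and lam = lam,
        OF \<Phi>0 \<Phi>1 assms(8) Fl lam1]
    let ?q = "cavity_map (lam ^ 3 - 1)"
    have q: "?q \<in> admissible \<Phi> lam"
      by (rule cav(2))
    have "integral {lam<..} ?F \<le> Q" unfolding Q_def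
      by (rule integral_subset_le)
        (use lam F0 set_lebesgue_integral_eq_integral(1)[OF F2] set_lebesgue_integral_eq_integral(1)[OF Fl] in auto)
    have l3: "lam ^ 3 \<ge> lam" using self_le_power[of lam 3] lam by simp
    have "c\<^sub>1 * (lam ^ 3 - 1) * integral {lam<..} ?F \<le> c\<^sub>1 * (lam ^ 3 - 1) * Q"
      using \<open>integral {lam<..} ?F \<le> Q\<close> assms(8) lam l3 by (intro mult_left_mono mult_nonneg_nonneg) auto
    also have "\<dots> \<le> c\<^sub>1 * Q * lam ^ 3" using Q assms(8) by (simp add: algebra_simps)
    finally have "I_mec \<Phi> ?q \<le> ennreal (c\<^sub>1 * Q * lam ^ 3)"
      using cav(1) ennreal_leI order_trans by blast
    then have "enn2ereal (I_mec \<Phi> ?q) \<le> ereal (c\<^sub>1 * Q * lam ^ 3)"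
      using Q assms(8) lam by (simp add: less_eq_ennreal.rep_eq enn2ereal_ennreal)
    moreover have "energy \<Phi> \<rho>\<^sub>0 ?q \<le> enn2ereal (I_mec \<Phi> ?q)"
      unfolding energy_def by (rule ereal_diff_le_self) simp
    moreover have "energy \<Phi> \<rho>\<^sub>0 r \<le> energy \<Phi> \<rho>\<^sub>0 ?q"
      unfolding min by (rule INF_lower[OF q])
    ultimately have upper: "energy \<Phi> \<rho>\<^sub>0 r \<le> ereal (c\<^sub>1 * Q * lam ^ 3)" by order
    show "r 0 > 0"
    proof (rule ccontr)
      assume "\<not> r 0 > 0"
      with admissibleD(4)[OF r] have r0: "r 0 = 0" by simp
      \<comment> \<open>Finiteness of the mechanical energy allows passage to real numbers and makes
        the potential energy finite too, so the difference of extended reals behaves as in the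
        reals.\<close>
      define E where "E = enn2real (I_mec \<Phi> r)"
      have E: "I_mec \<Phi> r = ennreal E" "E \<ge> 0"
        using admissibleD(5)[OF r] by (simp_all add: E_def)
      have "I_pot \<rho>\<^sub>0 r \<le> ennreal (B * ((9 * E / K + 3) / m\<^sup>2 + m))"
        using uncavitated_I_pot_le[where h = h and \<Phi> = \<Phi>, OF h r r0 K hK \<rho> m] by (simp add: B_def E_def)
      also have "B * ((9 * E / K + 3) / m\<^sup>2 + m) = E / 2 + C"
        unfolding m2 C_def using B K by (simp add: field_simps)
      finally have "enn2ereal (I_pot \<rho>\<^sub>0 r) \<le> ereal (E / 2 + C)"
        using enn2ereal_ennreal[of "E / 2 + C"] \<open>0 \<le> C\<close> E(2) by (simp only: less_eq_ennreal.rep_eq)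
      then have "ereal E - ereal (E / 2 + C) \<le> energy \<Phi> \<rho>\<^sub>0 r"
        unfolding energy_def E(1) using E(2) by (intro ereal_minus_mono) (simp_all add: enn2ereal_ennreal)
      then have "ereal (E / 2 - C) \<le> energy \<Phi> \<rho>\<^sub>0 r" by simp
      with upper have le: "E / 2 - C \<le> c\<^sub>1 * Q * lam ^ 3" by (metis ereal_less_eq(3) order_trans)
      have "ennreal (M * (lam ^ 3 / 8 - D)) \<le> ennreal E"
        using uncavitated_I_mec_ge[where h = h and \<Phi> = \<Phi>, OF h r r0 M D] by (simp add: E(1))
      then have "M * (lam ^ 3 / 8 - D) \<le> E" using E(2) by (simp add: ennreal_le_iff)
      then have "2 * (c\<^sub>1 * Q + 1) * lam ^ 3 - M * D \<le> E" by (simp add: M_def algebra_simps)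
      then have "lam ^ 3 \<le> M * D / 2 + C" using le by (simp add: algebra_simps)
      with l3 lam show False by linarith
    qed
  qed
qed

end
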